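(* Let $G$ be a countable discrete amenable group, $\{X_g\}_{g\in G}$ a finite-valued ergodic $G$-process with entropy $h$, and $\{F_n\}$ a tempered Følner sequence in $G$ with $|F_n|\ge n$. Let $\{W_n\}$ be a sequence of finite subsets of $G$ containing $1_G$ such that each $W_n$ is individually $C_n$-filling, and let $\{n(k)\}$ be a sequence of integers such that $\sum_{k=1}^\infty\frac{2^{-\alpha|F_k|}}{C_{n(k)}}<\infty$ for every $\alpha>0$. Then for almost every $x$, \[ \limsup_{k\to\infty}-\frac{1}{|F_k|}\log U^{(F,W)}_{k,n(k)}(x)\le h. \]
   Context: Setting: $\Sigma$ finite, $(\Omega,\mathcal F,P)$ a standard probability space with an ergodic measure-preserving free left $G$-action, $x(g)=X(gx)$ for measurable $X:\Omega\to\Sigma$; $h=\lim_k\frac1{|F_k|}H(\{X_g\}_{g\in F_k})$; logs base 2. $[x(E)]=\{x':x'(f)=x(f)\ \forall f\in E\}$. Tempered Følner: $|F_n\triangle gF_n|/|F_n|\to0$ for all $g$ and $|(\bigcup_{k<n}F_k^{-1})F_n|\le C|F_n|$. $x(F_k)$ repeats at $f$ if $fx\in[x(F_k)]$. $U_{k,n}^{(F,W)}(x)=\frac{1}{|W_n|}\max\{|E|: 1_G\in E\subseteq W_n,\ \{F_kf\}_{f\in E}\text{ pairwise disjoint},\ x(F_k)\text{ repeats at every }f\in E\}$. A finite set $W\ni1_G$ is individually $C$-filling if for every sequence $\{Wf_i\}_{i=1}^I$ with $f_i\notin\bigcup_{j<i}Wf_j$ one has $|\bigcup_iWf_i|\ge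 C\sum_i|Wf_i|$. *)

theory Defs
  imports "HOL-Probability.Probability"
begin

text \<open>The group G is a type 'g of class group_add (written additively, not
assumed commutative); 1_G is 0, the product gh is g + h, the inverse is -g.\<close>

definition translate_right :: "'g::group_add set \<Rightarrow> 'g \<Rightarrow> 'g set" where
  "translate_right A f = (\<lambda>a. a + f) ` A"

definition translate_left :: "'g::group_add \<Rightarrow> 'g set \<Rightarrow> 'g set" where
  "translate_left g A = (\<lambda>a. g + a) ` A"

definition set_prod :: "'g::group_add set \<Rightarrow> 'g set \<Rightarrow> 'g set" where
  "set_prod A B = {a + b | a b. a \<in> A \<and> b \<in> B}"

definition set_inv :: "'g::group_add set \<Rightarrow> 'g set" where
  "set_inv A = uminus ` A"

definition folner_seq :: "(nat \<Rightarrow> 'g::group_add set) \<Rightarrow> bool" where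
  "folner_seq F \<longleftrightarrow> (\<forall>n. finite (F n) \<and> F n \<noteq> {}) \<and>
     (\<forall>g. (\<lambda>n. real (card ((F n - translate_left g (F n)) \<union> (translate_left g (F n) - F n))) / real (card (F n))) \<longlonglongrightarrow> 0)"

definition tempered_folner_seq :: "(nat \<Rightarrow> 'g::group_add set) \<Rightarrow> bool" where
  "tempered_folner_seq F \<longleftrightarrow> folner_seq F \<and>
     (\<exists>C::real. \<forall>n. real (card (set_prod (\<Union>k<n. set_inv (F k)) (F n))) \<le> C * real (card (F n)))"

definition amenable :: "'g::group_add itself \<Rightarrow> bool" where
  "amenable _ \<longleftrightarrow> (\<exists>F::nat \<Rightarrow> 'g set. folner_seq F)"

definition mp_free_ergodic_action ::
    "'w measure \<Rightarrow> ('g::group_add \<Rightarrow> 'w \<Rightarrow> 'w) \<Rightarrow> bool" where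
  "mp_free_ergodic_action M act \<longleftrightarrow>
     (\<forall>w \<in> space M. act 0 w = w) \<and>
     (\<forall>g h. \<forall>w \<in> space M. act (g + h) w = act g (act h w)) \<and>
     (\<forall>g. act g \<in> M \<rightarrow>\<^sub>M M \<and> distr M M (act g) = M) \<and>
     (\<forall>g. \<forall>w \<in> space M. act g w = w \<longrightarrow> g = 0) \<and>
     (\<forall>A \<in> sets M. (\<forall>g. act g -` A \<inter> space M = A) \<longrightarrow>
        measure M A = 0 \<or> measure M A = 1)"

text \<open>Shannon entropy (base 2) of the finite collection {X_g}_{g in E}, with
  X_g(w) = X(g w).\<close>
definition block_entropy ::
    "'w measure \<Rightarrow> ('g \<Rightarrow> 'w \<Rightarrow> 'w) \<Rightarrow> ('w \<Rightarrow> 's::finite) \<Rightarrow> 'g set \<Rightarrow> real" where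
  "block_entropy M act X E =
     - (\<Sum>p \<in> PiE E (\<lambda>_. UNIV).
          let q = measure M {w \<in> space M. \<forall>g\<in>E. X (act g w) = p g} in q * log 2 q)"

definition repeats_at ::
    "('g::group_add \<Rightarrow> 'w \<Rightarrow> 'w) \<Rightarrow> ('w \<Rightarrow> 's) \<Rightarrow> 'g set \<Rightarrow> 'w \<Rightarrow> 'g \<Rightarrow> bool" where
  "repeats_at act X F w f \<longleftrightarrow> (\<forall>g\<in>F. X (act g (act f w)) = X (act g w))"

definition U_stat ::
    "('g::group_add \<Rightarrow> 'w \<Rightarrow> 'w) \<Rightarrow> ('w \<Rightarrow> 's) \<Rightarrow> 'g set \<Rightarrow> 'g set \<Rightarrow> 'w \<Rightarrow> real" where
  "U_stat act X Fk Wn w =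
     real (Max {card E | E. 0 \<in> E \<and> E \<subseteq> Wn \<and>
        (\<forall>f\<in>E. \<forall>f'\<in>E. f \<noteq> f' \<longrightarrow> translate_right Fk f \<inter> translate_right Fk f' = {}) \<and>
        (\<forall>f\<in>E. repeats_at act X Fk w f)}) / real (card Wn)"

definition individually_filling :: "'g::group_add set \<Rightarrow> real \<Rightarrow> bool" where
  "individually_filling W C \<longleftrightarrow> finite W \<and> 0 \<in> W \<and>
     (\<forall>fs::'g list. (\<forall>i<length fs. fs ! i \<notin> (\<Union>j<i. translate_right W (fs ! j))) \<longrightarrow>
        real (card (\<Union>i<length fs. translate_right W (fs ! i)))
          \<ge> C * (\<Sum>i<length fs. real (card (translate_right W (fs ! i)))))"

end

theory Submission
  imports Defs
begin

text \<open>
The proof is a first-moment argument over typical names. Two ingredients are needed.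

First, almost every point eventually has its \<open>F k\<close>-name in a set of at most \<open>2\<close> to the power
\<open>(h + \<epsilon>) |F k|\<close> names. For a fixed large window \<open>A = F j\<close>, the average over \<open>f \<in> F k\<close> of the
information of the \<open>A\<close>-name of \<open>f x\<close> tends to the entropy of \<open>A\<close> by the pointwise ergodic theorem;
the number of names for which this average is small is controlled by a Kraft-type inequality. No tiling
of \<open>F k\<close> is required, because a Finner (generalised Hoelder) inequality handles all overlapping
translates of \<open>A\<close> at once. The pointwise ergodic theorem itself follows from the mean ergodic theorem
and a maximal inequality, where temperedness lets one select translates greedily, from the largest
scale downwards.

Second, fix a name \<open>p\<close>. Where \<open>p\<close> occurs but recurs in the window \<open>W\<close> with packing density less than
\<open>\<delta>\<close>, its occurrences fill less than \<open>|A|\<^sup>2 \<delta> |W|\<close> of that window. Covering such places greedily by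
translates of \<open>W\<close>, the filling property bounds their density by \<open>|A|\<^sup>2 \<delta> / C\<close>. With
\<open>\<delta>\<close> equal to \<open>2\<close> to the power \<open>- (h + 3 \<epsilon>) |F k|\<close>, summing over the typical names and applying
Borel--Cantelli gives the claim.
\<close>

section \<open>Products and translates of finite subsets of the group\<close>

lemma finite_translate_right [simp]: "finite A \<Longrightarrow> finite (translate_right A f)"
  by (simp add: translate_right_def)

lemma card_translate_right [simp]: "card (translate_right A f) = card A"
  unfolding translate_right_def by (rule card_image) (simp add: inj_on_def)

lemma set_prod_translate_right: "set_prod A B = (\<Union>b\<in>B. translate_right A b)"
  by (auto simp: set_prod_def translate_right_def)

lemma set_prod_translate_left: "set_prod A B = (\<Union>a\<in>A. translate_left a B)"
  by (auto simp: set_prod_def translate_left_def)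

lemma finite_set_prod [simp]: "finite A \<Longrightarrow> finite B \<Longrightarrow> finite (set_prod A B)"
  by (simp add: set_prod_translate_right)

lemma set_prod_assoc: "set_prod (set_prod A B) D = set_prod A (set_prod B D)"
  unfolding set_prod_def by (auto; metis add.assoc)

lemma card_set_prod_le:
  assumes "finite B"
  shows "card (set_prod A B) \<le> card A * card B"
proof -
  have "card (set_prod A B) \<le> (\<Sum>b\<in>B. card (translate_right A b))"
    unfolding set_prod_translate_right by (rule card_UN_le[OF assms])
  then show ?thesis by (simp add: mult.commute)
qed

lemma mem_translate_right_iff: "v \<in> translate_right A f \<longleftrightarrow> v - f \<in> A"
  unfolding translate_right_def by (force simp: image_iff)

text \<open>A centre \<open>f\<close> with \<open>v\<close> in \<open>A f\<close> must be
  \<open>- a + v\<close> for some \<open>a\<close> in \<open>A\<close>. This multiplicity bound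
  drives the double counting in the covering argument and supplies the exponent in the Finner
  inequality.\<close>

lemma card_covering_translates_le:
  assumes "finite A"
  shows "card {f \<in> T. v \<in> translate_right A f} \<le> card A"
proof -
  have "{f \<in> T. v \<in> translate_right A f} \<subseteq> (\<lambda>a. - a + v) ` A"
    by (auto simp: translate_right_def image_iff) (metis add.assoc add_0 left_minus)
  then have "card {f \<in> T. v \<in> translate_right A f} \<le> card ((\<lambda>a. - a + v) ` A)"
    using assms by (intro card_mono) auto
  then show ?thesis using card_image_le[OF assms, of "\<lambda>a. - a + v"] by linarith
qed

text \<open>A collision \<open>a + f = b + g\<close> says \<open>f = - a + b + g\<close>. The
  centres to be avoided thus form a product set beginning with an inverse set, the shape whose size
  temperedness controls.\<close>

lemma translates_disjoint_iff:
  "translate_right A f \<inter> translate_right B g = {} \<longleftrightarrow> f \<notin> set_prod (set_prod (set_inv A) B) {g}"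
proof -
  have eq: "a + f = b + g \<longleftrightarrow> f = - a + b + g" for a b
    by (metis add.assoc add_minus_cancel minus_add_cancel)
  have "translate_right A f \<inter> translate_right B g \<noteq> {} \<longleftrightarrow> (\<exists>a\<in>A. \<exists>b\<in>B. a + f = b + g)"
    unfolding translate_right_def by blast
  also have "\<dots> \<longleftrightarrow> f \<in> set_prod (set_prod (set_inv A) B) {g}"
    unfolding eq set_prod_def set_inv_def by blast
  finally show ?thesis by blast
qed

section \<open>The maximal inequality for tempered sequences\<close>

text \<open>\<open>Y\<close> is chosen of maximal cardinality among the subsets of \<open>B\<close>
  whose union of translates carries at least half of what disjoint translates would carry.
  Maximality forces every translate centred in \<open>B\<close> to have half of its guaranteed mass
  inside that union, and double counting then bounds all of \<open>B\<close>, not only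
  \<open>Y\<close>.\<close>

lemma one_scale_covering:
  fixes \<phi> :: "'g::group_add \<Rightarrow> real" and r :: real
  assumes "finite F" "F \<noteq> {}" "finite B" and pos: "\<And>v. \<phi> v \<ge> 0" and "r \<ge> 0"
    and big: "\<And>b. b \<in> B \<Longrightarrow> r * card F \<le> (\<Sum>v\<in>translate_right F b. \<phi> v)"
  obtains Y where "Y \<subseteq> B" "r * card B \<le> 2 * (\<Sum>v\<in>set_prod F Y. \<phi> v)"
    "r * card F * card Y \<le> 2 * (\<Sum>v\<in>set_prod F Y. \<phi> v)"
proof -
  define Q where "Q Y \<longleftrightarrow> Y \<subseteq> B \<and> r * card F * card Y \<le> 2 * (\<Sum>v\<in>set_prod F Y. \<phi> v)" for Y
  have "Q {}" by (simp add: Q_def set_prod_def)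
  moreover have "card Y \<le> card B" if "Q Y" for Y
    using that \<open>finite B\<close> by (auto simp: Q_def intro: card_mono)
  ultimately have "\<exists>Y. Q Y \<and> (\<forall>Z. Q Z \<longrightarrow> card Z \<le> card Y)"
    by (intro ex_has_greatest_nat[where b = "Suc (card B)"]) (auto simp: less_Suc_eq_le)
  then obtain Y where Y: "Q Y" and Ymax: "\<And>Z. Q Z \<Longrightarrow> card Z \<le> card Y"
    by blast
  have fY: "finite Y" using Y \<open>finite B\<close> finite_subset by (auto simp: Q_def)
  let ?P = "set_prod F Y" and ?m = "real (card F)"
  have fP: "finite ?P" using \<open>finite F\<close> fY by simp
  \<comment> \<open>If \<open>a\<close> is not in \<open>Y\<close>, then \<open>insert a Y\<close>
    violates \<open>Q\<close>, so the translate at \<open>a\<close> adds mass less than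
    \<open>r * ?m / 2\<close>; the rest of its mass lies in \<open>?P\<close> already.\<close>
  have half: "r * ?m \<le> 2 * (\<Sum>v\<in>translate_right F a \<inter> ?P. \<phi> v)" if a: "a \<in> B" for a
  proof (cases "a \<in> Y")
    case True
    then have "translate_right F a \<inter> ?P = translate_right F a"
      by (auto simp: set_prod_translate_right)
    moreover have "(\<Sum>v\<in>translate_right F a. \<phi> v) \<ge> 0" by (simp add: pos sum_nonneg)
    ultimately show ?thesis using big[OF a] by simp
  next
    case False
    have "\<not> Q (insert a Y)" using Ymax[of "insert a Y"] False fY by auto
    then have "2 * (\<Sum>v\<in>set_prod F (insert a Y). \<phi> v) < r * ?m * (card Y + 1)"
      using a Y False fY by (auto simp: Q_def)
    moreover have "set_prod F (insert a Y) = ?P \<union> (translate_right F a - ?P)"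
      by (auto simp: set_prod_translate_right)
    then have "(\<Sum>v\<in>set_prod F (insert a Y). \<phi> v)
        = (\<Sum>v\<in>?P. \<phi> v) + (\<Sum>v\<in>translate_right F a - ?P. \<phi> v)"
      using fP \<open>finite F\<close> by (simp only: sum.union_disjoint[OF _ _ Diff_disjoint] finite_Diff finite_translate_right)
    moreover have "(\<Sum>v\<in>translate_right F a. \<phi> v)
        = (\<Sum>v\<in>translate_right F a \<inter> ?P. \<phi> v) + (\<Sum>v\<in>translate_right F a - ?P. \<phi> v)"
      using \<open>finite F\<close> by (intro sum.Int_Diff) simp
    ultimately show ?thesis using big[OF a] Y by (auto simp: Q_def algebra_simps)
  qed
  have "r * ?m * card B \<le> (\<Sum>a\<in>B. 2 * (\<Sum>v\<in>translate_right F a \<inter> ?P. \<phi> v))"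
    using sum_mono[of B "\<lambda>_. r * ?m", OF half] by (simp add: mult.commute)
  also have "\<dots> = 2 * (\<Sum>a\<in>B. \<Sum>v\<in>{v \<in> ?P. v \<in> translate_right F a}. \<phi> v)"
    by (simp add: sum_distrib_left Int_def conj_commute)
  also have "\<dots> = 2 * (\<Sum>v\<in>?P. \<Sum>a\<in>{a \<in> B. v \<in> translate_right F a}. \<phi> v)"
    using fP \<open>finite B\<close> by (simp add: sum.swap_restrict)
  also have "\<dots> \<le> 2 * (\<Sum>v\<in>?P. ?m * \<phi> v)"
    using card_covering_translates_le[OF \<open>finite F\<close>]
    by (intro mult_left_mono sum_mono) (auto intro!: mult_right_mono simp: pos)
  also have "\<dots> = ?m * (2 * (\<Sum>v\<in>?P. \<phi> v))" by (simp add: sum_distrib_left mult_ac)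
  finally have "?m * (r * card B) \<le> ?m * (2 * (\<Sum>v\<in>?P. \<phi> v))" by (simp add: mult_ac)
  then have "r * card B \<le> 2 * (\<Sum>v\<in>?P. \<phi> v)"
    using assms(1,2) by (simp add: mult_le_cancel_left_pos card_gt_0_iff)
  with Y that show ?thesis by (auto simp: Q_def)
qed

text \<open>Induction on the number of scales, treating the largest one first. The centres that are
  big at that scale are handled by \<open>one_scale_covering\<close>. Centres whose smaller
  translates could meet the selected union are discarded; by temperedness they are few enough to be
  paid for by the mass of that union. What remains lives in the complement of the union, so the
  masses add up.\<close>

lemma combinatorial_maximal_inequality:
  fixes \<phi> :: "'g::group_add \<Rightarrow> real" and F :: "nat \<Rightarrow> 'g set" and r C :: real
  assumes fin: "\<And>k. finite (F k)" and ne: "\<And>k. F k \<noteq> {}"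
    and tempered: "\<And>k. card (set_prod (\<Union>j<k. set_inv (F j)) (F k)) \<le> C * card (F k)"
    and pos: "\<And>v. \<phi> v \<ge> 0" and "r \<ge> 0"
    and "finite B" "finite D"
    and "\<And>k b. k < N \<Longrightarrow> b \<in> B \<Longrightarrow> translate_right (F k) b \<subseteq> D"
    and "\<And>b. b \<in> B \<Longrightarrow> \<exists>k<N. r * card (F k) \<le> (\<Sum>v\<in>translate_right (F k) b. \<phi> v)"
  shows "r * card B \<le> 2 * (1 + C) * (\<Sum>v\<in>D. \<phi> v)"
  using assms(6-)
proof (induction N arbitrary: B D)
  case 0
  have "0 \<le> C * card (F 0)" using tempered[of 0] order_trans of_nat_0_le_iff by blast
  then have "C \<ge> 0" using fin[of 0] ne[of 0] by (simp add: zero_le_mult_iff card_gt_0_iff)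
  then have "0 \<le> 2 * (1 + C) * (\<Sum>v\<in>D. \<phi> v)" by (simp add: pos sum_nonneg)
  moreover have "B = {}" using 0 by blast
  ultimately show ?case by simp
next
  case (Suc N)
  let ?K = "\<Union>j<N. set_inv (F j)"
  define B1 where "B1 = {b \<in> B. r * card (F N) \<le> (\<Sum>v\<in>translate_right (F N) b. \<phi> v)}"
  have fB1: "finite B1" using Suc.prems(1) by (simp add: B1_def)
  have bigB1: "\<And>b. b \<in> B1 \<Longrightarrow> r * card (F N) \<le> (\<Sum>v\<in>translate_right (F N) b. \<phi> v)"
    by (simp add: B1_def)
  obtain Y where Y: "Y \<subseteq> B1" "r * card B1 \<le> 2 * (\<Sum>v\<in>set_prod (F N) Y. \<phi> v)"
    "r * card (F N) * card Y \<le> 2 * (\<Sum>v\<in>set_prod (F N) Y. \<phi> v)"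
    using one_scale_covering[OF fin ne fB1 pos \<open>r \<ge> 0\<close> bigB1] by blast
  let ?P = "set_prod (F N) Y"
  have fY: "finite Y" using Y(1) fB1 finite_subset by blast
  have fK: "finite ?K" using fin by (auto simp: set_inv_def)
  have PD: "?P \<subseteq> D"
    using Y(1) Suc.prems(3)[of N] by (auto simp: set_prod_translate_right B1_def)
  \<comment> \<open>\<open>set_prod ?K ?P\<close> contains every centre whose translate at a scale
    below \<open>N\<close> meets \<open>?P\<close>, so the induction hypothesis applies to
    \<open>B2\<close> with \<open>D - ?P\<close> as the ambient set.\<close>
  define B2 where "B2 = B - B1 - set_prod ?K ?P"
  have IH: "r * card B2 \<le> 2 * (1 + C) * (\<Sum>v\<in>D - ?P. \<phi> v)"
  proof (rule Suc.IH)
    show "finite B2" "finite (D - ?P)" using Suc.prems by (auto simp: B2_def)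
    show "\<exists>k<N. r * card (F k) \<le> (\<Sum>v\<in>translate_right (F k) b. \<phi> v)" if "b \<in> B2" for b
      using Suc.prems(4)[of b] that by (auto simp: B2_def B1_def less_Suc_eq)
    show "translate_right (F k) b \<subseteq> D - ?P" if k: "k < N" and b: "b \<in> B2" for k b
    proof -
      have "translate_right (F k) b \<inter> translate_right (F N) y = {}" if "y \<in> Y" for y
      proof -
        have "set_prod (set_prod (set_inv (F k)) (F N)) {y} \<subseteq> set_prod ?K ?P"
          unfolding set_prod_assoc unfolding set_prod_def using that k by blast
        then show ?thesis using b by (subst translates_disjoint_iff) (auto simp: B2_def)
      qed
      then show ?thesis
        using Suc.prems(3)[of k b] k b by (auto simp: set_prod_translate_right[of "F N"] B2_def)
    qed
  qed
  have "card (set_prod ?K ?P) \<le> card (set_prod ?K (F N)) * card Y"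
    using card_set_prod_le[OF fY] by (metis set_prod_assoc)
  then have "real (card (set_prod ?K ?P)) \<le> real (card (set_prod ?K (F N))) * card Y"
    by (metis of_nat_le_iff of_nat_mult)
  also have "\<dots> \<le> C * card (F N) * card Y"
    by (intro mult_right_mono tempered) auto
  finally have rem: "real (card (set_prod ?K ?P)) \<le> C * card (F N) * card Y" .
  have "C \<ge> 0"
  proof -
    have "0 \<le> C * card (F N)" using tempered[of N] order_trans of_nat_0_le_iff by blast
    then show ?thesis using fin[of N] ne[of N] by (simp add: zero_le_mult_iff card_gt_0_iff)
  qed
  have "B \<subseteq> B1 \<union> B2 \<union> set_prod ?K ?P" by (auto simp: B2_def)
  then have "card B \<le> card (B1 \<union> B2 \<union> set_prod ?K ?P)"
    using fB1 Suc.prems(1) fK fin fY by (intro card_mono) (auto simp: B2_def)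
  also have "\<dots> \<le> card B1 + card B2 + card (set_prod ?K ?P)"
    by (meson add_mono card_Un_le order_refl order_trans)
  finally have "real (card B) \<le> card B1 + card B2 + C * card (F N) * card Y"
    using rem by linarith
  then have "r * card B \<le> r * (card B1 + card B2 + C * card (F N) * card Y)"
    using \<open>r \<ge> 0\<close> by (rule mult_left_mono)
  also have "\<dots> = r * card B1 + r * card B2 + C * (r * card (F N) * card Y)"
    by (simp add: algebra_simps)
  \<comment> \<open>On \<open>?P\<close> the coefficient is \<open>2\<close> for the centres in
    \<open>B1\<close> plus \<open>2 * C\<close> for the discarded ones, which matches the
    coefficient on \<open>D - ?P\<close>.\<close>
  also have "\<dots> \<le> 2 * (\<Sum>v\<in>?P. \<phi> v) + 2 * (1 + C) * (\<Sum>v\<in>D - ?P. \<phi> v) + C * (2 * (\<Sum>v\<in>?P. \<phi> v))"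
    using Y IH \<open>C \<ge> 0\<close> by (intro add_mono mult_left_mono) auto
  also have "\<dots> = 2 * (1 + C) * (\<Sum>v\<in>D. \<phi> v)"
    using PD Suc.prems(2) by (subst sum.subset_diff[of ?P D]) (auto simp: algebra_simps)
  finally show ?case .
qed

section \<open>Folner sequences and transference\<close>

lemma folner_seq_finite: "folner_seq F \<Longrightarrow> finite (F n)"
  and folner_seq_nonempty: "folner_seq F \<Longrightarrow> F n \<noteq> {}"
  and folner_seq_card_pos: "folner_seq F \<Longrightarrow> card (F n) > 0"
  by (auto simp: folner_seq_def card_gt_0_iff)

text \<open>The part of \<open>K F\<close> outside \<open>F\<close> is covered by the differences of
  the translates \<open>g F\<close>, \<open>g\<close> in \<open>K\<close>, from \<open>F\<close>.
  This boundary term is the error both in transference and in the count of names.\<close>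

lemma folner_seq_set_prod:
  assumes F: "folner_seq F" and K: "finite K"
  shows "(\<lambda>n. real (card (set_prod K (F n) - F n)) / card (F n)) \<longlonglongrightarrow> 0"
proof (rule tendsto_sandwich[OF _ _ tendsto_const])
  let ?d = "\<lambda>g n. real (card ((F n - translate_left g (F n)) \<union> (translate_left g (F n) - F n)))"
  show "(\<lambda>n. \<Sum>g\<in>K. ?d g n / card (F n)) \<longlonglongrightarrow> 0"
    using F by (intro tendsto_null_sum) (simp add: folner_seq_def)
  have "real (card (set_prod K (F n) - F n)) \<le> (\<Sum>g\<in>K. ?d g n)" for n
  proof -
    have "card (set_prod K (F n) - F n) \<le> card (\<Union>g\<in>K. translate_left g (F n) - F n)"
      using K folner_seq_finite[OF F]
      by (intro card_mono) (auto simp: set_prod_translate_left translate_left_def)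
    also have "\<dots> \<le> (\<Sum>g\<in>K. card (translate_left g (F n) - F n))"
      by (rule card_UN_le[OF K])
    also have "\<dots> \<le> (\<Sum>g\<in>K. card ((F n - translate_left g (F n)) \<union> (translate_left g (F n) - F n)))"
      using folner_seq_finite[OF F]
      by (intro sum_mono card_mono) (auto simp: translate_left_def)
    finally have "real (card (set_prod K (F n) - F n)) \<le>
        real (\<Sum>g\<in>K. card ((F n - translate_left g (F n)) \<union> (translate_left g (F n) - F n)))"
      by (simp only: of_nat_le_iff)
    then show ?thesis by (simp only: of_nat_sum)
  qed
  then show "\<forall>\<^sub>F n in sequentially. real (card (set_prod K (F n) - F n)) / card (F n)
      \<le> (\<Sum>g\<in>K. ?d g n / card (F n))"
    by (simp add: sum_divide_distrib[symmetric] divide_right_mono)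
qed auto

section \<open>Measure-preserving actions: from orbit estimates to probabilities\<close>

locale mp_action = prob_space M for M :: "'w measure" +
  fixes act :: "'g::group_add \<Rightarrow> 'w \<Rightarrow> 'w"
  assumes act_zero [simp]: "w \<in> space M \<Longrightarrow> act 0 w = w"
    and act_add: "w \<in> space M \<Longrightarrow> act (g + h) w = act g (act h w)"
    and measurable_act [measurable]: "act g \<in> M \<rightarrow>\<^sub>M M"
    and distr_act: "distr M M (act g) = M"
begin

lemma act_space [simp]: "w \<in> space M \<Longrightarrow> act g w \<in> space M"
  using measurable_space[OF measurable_act] .

lemma integral_act:
  fixes f :: "'w \<Rightarrow> real"
  assumes "f \<in> borel_measurable M"
  shows "(\<integral>w. f (act g w) \<partial>M) = (\<integral>w. f w \<partial>M)"
  using integral_distr[OF measurable_act assms, of g] by (simp add: distr_act)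

lemma integrable_act:
  fixes f :: "'w \<Rightarrow> real"
  assumes "integrable M f"
  shows "integrable M (\<lambda>w. f (act g w))"
  using integrable_distr[OF measurable_act[of g], of f] assms by (simp add: distr_act)

lemma AE_act:
  assumes "AE w in M. P w"
  shows "AE w in M. P (act g w)"
  by (rule AE_distrD[OF measurable_act[of g]]) (simp only: distr_act assms)

text \<open>The orbit-wise bound is integrated with \<open>T = F n\<close>. By invariance the left
  side becomes \<open>card (F n)\<close> times the probability of \<open>B\<close>, the right side
  \<open>c\<close> times the size of \<open>K F n\<close> times the integral, and the ratio of the
  two sizes is at most \<open>1 + o(1)\<close> by the Folner property.\<close>

lemma transference:
  fixes \<phi> :: "'w \<Rightarrow> real" and F :: "nat \<Rightarrow> 'g set"
  assumes F: "folner_seq F" and K: "finite K" and B: "B \<in> sets M"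
    and int: "integrable M \<phi>" and pos: "\<And>w. \<phi> w \<ge> 0" and "c \<ge> 0"
    and bound: "\<And>w T. w \<in> space M \<Longrightarrow> finite T \<Longrightarrow>
      card {g \<in> T. act g w \<in> B} \<le> c * (\<Sum>v\<in>set_prod K T. \<phi> (act v w))"
  shows "prob B \<le> c * (\<integral>w. \<phi> w \<partial>M)"
proof -
  let ?I = "\<integral>w. \<phi> w \<partial>M"
  note [measurable] = B
  have I: "?I \<ge> 0" by (simp add: pos)
  have "prob B \<le> c * (1 + card (set_prod K (F n) - F n) / card (F n)) * ?I" for n
  proof -
    let ?T = "F n" and ?KT = "set_prod K (F n)"
    have T: "finite ?T" "card ?T > 0" using F by (auto simp: folner_seq_finite folner_seq_card_pos)
    have intB: "integrable M (\<lambda>w. indicator B (act g w) :: real)" for g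
      by (intro integrable_act) (simp add: B emeasure_eq_measure)
    have "card ?T * prob B = (\<Sum>g\<in>?T. \<integral>w. indicator B (act g w) \<partial>M)"
      using sets.sets_into_space[OF B] by (simp add: integral_act Int_absorb1)
    also have "\<dots> = (\<integral>w. (\<Sum>g\<in>?T. indicator B (act g w)) \<partial>M)"
      using intB by simp
    also have "\<dots> \<le> (\<integral>w. c * (\<Sum>v\<in>?KT. \<phi> (act v w)) \<partial>M)"
    proof (rule integral_mono)
      show "(\<Sum>g\<in>?T. indicator B (act g w) :: real) \<le> c * (\<Sum>v\<in>?KT. \<phi> (act v w))"
        if "w \<in> space M" for w
        using bound[OF that T(1)] T(1) by (simp add: indicator_def sum.If_cases Int_def)
    qed (use intB integrable_act[OF int] in auto)
    also have "\<dots> = c * (card ?KT * ?I)"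
      using integrable_act[OF int] integral_act[of \<phi>] int by simp
    also have "\<dots> \<le> c * ((card ?T + card (?KT - ?T)) * ?I)"
    proof -
      have "?KT \<subseteq> ?T \<union> (?KT - ?T)" by blast
      then have "card ?KT \<le> card (?T \<union> (?KT - ?T))" using T K by (intro card_mono) auto
      also have "\<dots> \<le> card ?T + card (?KT - ?T)" by (rule card_Un_le)
      finally show ?thesis using I \<open>c \<ge> 0\<close> by (intro mult_left_mono mult_right_mono) auto
    qed
    finally show ?thesis using T(2) by (simp add: field_simps)
  qed
  moreover have "(\<lambda>n. c * (1 + card (set_prod K (F n) - F n) / card (F n)) * ?I) \<longlonglongrightarrow> c * (1 + 0) * ?I"
    by (intro tendsto_intros folner_seq_set_prod F K)
  ultimately have "prob B \<le> c * (1 + 0) * ?I"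
    by (intro LIMSEQ_le_const[where a = "prob B"]) auto
  then show ?thesis by simp
qed

definition ave :: "'g set \<Rightarrow> ('w \<Rightarrow> real) \<Rightarrow> 'w \<Rightarrow> real" where
  "ave A \<phi> w = (\<Sum>g\<in>A. \<phi> (act g w)) / card A"

lemma ave_measurable [measurable]:
  assumes [measurable]: "\<phi> \<in> borel_measurable M"
  shows "ave A \<phi> \<in> borel_measurable M"
  unfolding ave_def by measurable

text \<open>The combinatorial inequality is applied along each orbit and transferred. Only scales
  below \<open>N\<close> are treated at once; the bound does not depend on \<open>N\<close>, so
  continuity from below removes the truncation.\<close>

lemma maximal_inequality:
  fixes \<phi> :: "'w \<Rightarrow> real" and F :: "nat \<Rightarrow> 'g set" and C r :: real
  assumes F: "folner_seq F"
    and tempered: "\<And>k. card (set_prod (\<Union>j<k. set_inv (F j)) (F k)) \<le> C * card (F k)"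
    and int: "integrable M \<phi>" and pos: "\<And>w. \<phi> w \<ge> 0" and "r > 0"
  shows "prob {w \<in> space M. \<exists>k. ave (F k) \<phi> w \<ge> r} \<le> 2 * (1 + C) / r * (\<integral>w. \<phi> w \<partial>M)"
proof -
  have [measurable]: "\<phi> \<in> borel_measurable M" using int by simp
  define B where "B N = {w \<in> space M. \<exists>k<N. ave (F k) \<phi> w \<ge> r}" for N :: nat
  have [measurable]: "B N \<in> sets M" for N unfolding B_def by measurable
  have "0 \<le> C * card (F 0)" using tempered[of 0] order_trans of_nat_0_le_iff by blast
  then have C: "C \<ge> 0" using folner_seq_card_pos[OF F, of 0] by (simp add: zero_le_mult_iff)
  have "prob (B N) \<le> 2 * (1 + C) / r * (\<integral>w. \<phi> w \<partial>M)" for N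
  \<comment> \<open>This \<open>K\<close> makes \<open>set_prod K T\<close> contain every translate
    of \<open>F k\<close>, \<open>k < N\<close>, centred in \<open>T\<close>.\<close>
  proof (rule transference[OF F, where K = "\<Union>k<N. F k"])
    show "card {g \<in> T. act g w \<in> B N} \<le> 2 * (1 + C) / r * (\<Sum>v\<in>set_prod (\<Union>k<N. F k) T. \<phi> (act v w))"
      if w: "w \<in> space M" and T: "finite T" for w T
    proof -
      let ?S = "{g \<in> T. act g w \<in> B N}"
      have "r * card ?S \<le> 2 * (1 + C) * (\<Sum>v\<in>set_prod (\<Union>k<N. F k) T. \<phi> (act v w))"
      proof (rule combinatorial_maximal_inequality[where F = F and N = N])
        show "translate_right (F k) b \<subseteq> set_prod (\<Union>k<N. F k) T" if "k < N" "b \<in> ?S" for k b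
          using that unfolding set_prod_def translate_right_def by blast
        show "\<exists>k<N. r * card (F k) \<le> (\<Sum>v\<in>translate_right (F k) b. \<phi> (act v w))"
          if b: "b \<in> ?S" for b
        proof -
          obtain k where k: "k < N" "ave (F k) \<phi> (act b w) \<ge> r" using b by (auto simp: B_def)
          have "(\<Sum>v\<in>translate_right (F k) b. \<phi> (act v w)) = (\<Sum>g\<in>F k. \<phi> (act g (act b w)))"
            unfolding translate_right_def
            by (subst sum.reindex) (auto simp: inj_on_def act_add[OF w])
          moreover have "r * card (F k) \<le> (\<Sum>g\<in>F k. \<phi> (act g (act b w)))"
            using k(2) folner_seq_card_pos[OF F, of k] by (simp add: ave_def pos_le_divide_eq)
          ultimately show ?thesis using k(1) by auto
        qed
        show "r \<ge> 0" using \<open>r > 0\<close> by simp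
        show "finite ?S" "finite (set_prod (\<Union>k<N. F k) T)"
          using T by (simp_all add: folner_seq_finite[OF F])
      qed (rule pos tempered folner_seq_finite[OF F] folner_seq_nonempty[OF F])+
      with \<open>r > 0\<close> show ?thesis by (simp add: field_simps)
    qed
  qed (use C \<open>r > 0\<close> in \<open>simp_all add: pos int folner_seq_finite[OF F]\<close>)
  moreover have "(\<lambda>N. prob (B N)) \<longlonglongrightarrow> prob (\<Union>N. B N)"
    by (intro finite_Lim_measure_incseq) (auto simp: incseq_def B_def dest: less_le_trans)
  moreover have "(\<Union>N. B N) = {w \<in> space M. \<exists>k. ave (F k) \<phi> w \<ge> r}"
    by (auto simp: B_def)
  ultimately show ?thesis by (intro LIMSEQ_le_const2) auto
qed

end

section \<open>The mean and pointwise ergodic theorems\<close>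

context mp_action
begin

text \<open>Dyadic convex combinations of translates of \<open>\<psi>\<close>. Midpoints are all
  that the parallelogram law asks for, and rule induction carries bounds, integrals and the
  behaviour of averages over from \<open>\<psi>\<close>.\<close>

inductive_set mean_hull :: "('w \<Rightarrow> real) \<Rightarrow> ('w \<Rightarrow> real) set" for \<psi> where
  hull_base: "\<psi> \<in> mean_hull \<psi>"
| hull_midpoint: "u \<in> mean_hull \<psi> \<Longrightarrow> v \<in> mean_hull \<psi> \<Longrightarrow> (\<lambda>w. (u w + v w) / 2) \<in> mean_hull \<psi>"
| hull_shift: "u \<in> mean_hull \<psi> \<Longrightarrow> (\<lambda>w. u (act g w)) \<in> mean_hull \<psi>"

lemma hull_measurable:
  assumes "\<psi> \<in> borel_measurable M" "u \<in> mean_hull \<psi>"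
  shows "u \<in> borel_measurable M"
  using assms(2)
proof induction
  case (hull_midpoint u v)
  then show ?case by (intro borel_measurable_divide borel_measurable_add borel_measurable_const)
next
  case (hull_shift u g)
  then show ?case by measurable
qed (rule assms(1))

lemma hull_bounded:
  assumes "\<And>w. \<bar>\<psi> w\<bar> \<le> b" "u \<in> mean_hull \<psi>"
  shows "\<bar>u w\<bar> \<le> b"
  using assms(2)
proof (induction arbitrary: w)
  case (hull_midpoint u v)
  have "\<bar>u w + v w\<bar> \<le> \<bar>u w\<bar> + \<bar>v w\<bar>" by (rule abs_triangle_ineq)
  then show ?case using hull_midpoint.IH(1)[of w] hull_midpoint.IH(2)[of w] by simp
qed (use assms(1) in auto)

lemma integrable_bounded:
  fixes f :: "'w \<Rightarrow> real"
  assumes "f \<in> borel_measurable M" "\<And>w. \<bar>f w\<bar> \<le> b"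
  shows "integrable M f"
  by (rule integrable_const_bound[where B = b]) (use assms in auto)

lemma hull_integrable:
  assumes "\<psi> \<in> borel_measurable M" "\<And>w. \<bar>\<psi> w\<bar> \<le> b" "u \<in> mean_hull \<psi>"
  shows "integrable M u"
  by (rule integrable_bounded[OF hull_measurable[OF assms(1,3)] hull_bounded[OF assms(2,3)]])

lemma hull_integral:
  assumes "\<psi> \<in> borel_measurable M" "\<And>w. \<bar>\<psi> w\<bar> \<le> b" "u \<in> mean_hull \<psi>"
  shows "(\<integral>w. u w \<partial>M) = (\<integral>w. \<psi> w \<partial>M)"
  using assms(3)
proof induction
  case (hull_midpoint u v)
  then show ?case using hull_integrable[OF assms(1,2)] by simp
next
  case (hull_shift u g)
  then show ?case using hull_measurable[OF assms(1)] by (simp add: integral_act)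
qed simp

text \<open>Shifting the function by \<open>g\<close> replaces the sum over \<open>F k\<close> by
  the sum over the left translate of \<open>F k\<close> by \<open>g\<close>. The two sums differ
  only on the symmetric difference, where each term is at most \<open>b\<close> in absolute
  value.\<close>

lemma ave_shift:
  fixes F :: "nat \<Rightarrow> 'g set"
  assumes F: "folner_seq F" and b: "\<And>w. \<bar>u w\<bar> \<le> b" and w: "w \<in> space M"
  shows "(\<lambda>k. ave (F k) (\<lambda>w. u (act g w)) w - ave (F k) u w) \<longlonglongrightarrow> 0"
proof (rule Lim_null_comparison)
  let ?d = "\<lambda>k. card ((F k - translate_left g (F k)) \<union> (translate_left g (F k) - F k))"
  have "\<bar>ave (F k) (\<lambda>w. u (act g w)) w - ave (F k) u w\<bar> \<le> b * (?d k / card (F k))" for k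
  proof -
    let ?A = "F k" and ?B = "translate_left g (F k)" and ?u = "\<lambda>f. u (act f w)"
    have fin: "finite ?A" "finite ?B"
      using folner_seq_finite[OF F] by (auto simp: translate_left_def)
    have "(\<Sum>f\<in>?A. u (act g (act f w))) = sum ?u ?B"
      unfolding translate_left_def by (subst sum.reindex) (auto simp: inj_on_def act_add[OF w])
    then have "ave ?A (\<lambda>w. u (act g w)) w - ave ?A u w = (sum ?u ?B - sum ?u ?A) / card ?A"
      by (simp add: ave_def diff_divide_distrib)
    also have "sum ?u ?B - sum ?u ?A = sum ?u (?B - ?A) - sum ?u (?A - ?B)"
      using sum.Int_Diff[OF fin(1), of ?u ?B] sum.Int_Diff[OF fin(2), of ?u ?A]
      by (simp add: Int_commute)
    finally have eq: "ave ?A (\<lambda>w. u (act g w)) w - ave ?A u w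
      = (sum ?u (?B - ?A) - sum ?u (?A - ?B)) / card ?A" .
    have bd: "\<bar>sum ?u D\<bar> \<le> b * card D" for D
      using order_trans[OF sum_abs sum_bounded_above[of D "\<lambda>f. \<bar>?u f\<bar>" b]] b
      by (simp add: mult.commute)
    have "\<bar>sum ?u (?B - ?A) - sum ?u (?A - ?B)\<bar> \<le> b * card (?B - ?A) + b * card (?A - ?B)"
      using bd[of "?B - ?A"] bd[of "?A - ?B"] by linarith
    also have "\<dots> = b * ?d k"
      using fin by (subst card_Un_disjoint) (auto simp: algebra_simps)
    finally show ?thesis unfolding eq by (simp add: divide_right_mono)
  qed
  then show "\<forall>\<^sub>F k in sequentially. norm (ave (F k) (\<lambda>w. u (act g w)) w - ave (F k) u w)
      \<le> b * (?d k / card (F k))" by simp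
  show "(\<lambda>k. b * (?d k / card (F k))) \<longlonglongrightarrow> 0"
    using F by (intro tendsto_mult_right_zero) (simp add: folner_seq_def)
qed

text \<open>At every point the averages of \<open>\<psi>\<close> may therefore be replaced by those
  of any element of its hull, in particular by those of one with small integral norm.\<close>

lemma ave_hull:
  fixes F :: "nat \<Rightarrow> 'g set"
  assumes F: "folner_seq F" and b: "\<And>w. \<bar>\<psi> w\<bar> \<le> b" and w: "w \<in> space M" and "u \<in> mean_hull \<psi>"
  shows "(\<lambda>k. ave (F k) u w - ave (F k) \<psi> w) \<longlonglongrightarrow> 0"
  using \<open>u \<in> mean_hull \<psi>\<close>
proof induction
  case (hull_midpoint u v)
  have "ave A (\<lambda>w. (u w + v w) / 2) w = (ave A u w + ave A v w) / 2" for A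
    by (simp add: ave_def sum.distrib sum_divide_distrib[symmetric] add_divide_distrib)
  then have "(\<lambda>k. ave (F k) (\<lambda>w. (u w + v w) / 2) w - ave (F k) \<psi> w)
    = (\<lambda>k. ((ave (F k) u w - ave (F k) \<psi> w) + (ave (F k) v w - ave (F k) \<psi> w)) / 2)"
    by (auto simp: field_simps)
  moreover have "\<dots> \<longlonglongrightarrow> (0 + 0) / 2"
    by (intro tendsto_intros hull_midpoint.IH) simp
  ultimately show ?case by simp
next
  case (hull_shift u g)
  have "\<bar>u w\<bar> \<le> b" for w by (rule hull_bounded[OF b hull_shift.hyps])
  then have "(\<lambda>k. (ave (F k) (\<lambda>w. u (act g w)) w - ave (F k) u w)
      + (ave (F k) u w - ave (F k) \<psi> w)) \<longlonglongrightarrow> 0 + 0"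
    by (intro tendsto_add hull_shift.IH ave_shift[OF F _ w, where b = b])
  then show ?case by simp
qed simp

end

section \<open>Ergodic actions: mean and pointwise convergence\<close>

locale ergodic_action = mp_action M act
  for M :: "'w measure" and act :: "'g::{group_add, countable} \<Rightarrow> 'w \<Rightarrow> 'w" +
  assumes ergodic: "A \<in> sets M \<Longrightarrow> (\<And>g. act g -` A \<inter> space M = A) \<Longrightarrow> prob A = 0 \<or> prob A = 1"
begin

text \<open>For each rational \<open>q\<close>, the truth value of \<open>v w > q\<close> is almost
  surely constant by ergodicity, and two reals with the same rationals below them are equal.\<close>

lemma invariant_AE_const:
  fixes v :: "'w \<Rightarrow> real"
  assumes [measurable]: "v \<in> borel_measurable M" and inv: "\<And>g. AE w in M. v (act g w) = v w"
  obtains c where "AE w in M. v w = c"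
proof -
  have "AE w in M. v w > of_rat q \<longleftrightarrow> prob {w \<in> space M. \<forall>g. v (act g w) > of_rat q} = 1" for q :: rat
  proof -
    \<comment> \<open>Ergodicity speaks of strictly invariant sets, whereas \<open>v\<close> is
      invariant only almost everywhere. Asking for the inequality along the whole orbit gives a
      strictly invariant set that agrees with the level set up to a null set, the group being
      countable.\<close>
    let ?A = "{w \<in> space M. \<forall>g. v (act g w) > of_rat q}"
    have "act h w \<in> ?A \<longleftrightarrow> w \<in> ?A" if w: "w \<in> space M" for h w
    proof -
      have "act h w \<in> ?A \<longleftrightarrow> (\<forall>g. v (act (g + h) w) > of_rat q)"
        using w by (simp add: act_add)
      also have "\<dots> \<longleftrightarrow> (\<forall>g. v (act g w) > of_rat q)"
        by (metis diff_add_cancel)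
      finally show ?thesis using w by simp
    qed
    then have "act h -` ?A \<inter> space M = ?A" for h by blast
    moreover have A: "?A \<in> sets M" by measurable
    ultimately have "prob ?A = 0 \<or> prob ?A = 1" by (intro ergodic)
    then have "AE w in M. w \<in> ?A \<longleftrightarrow> prob ?A = 1"
    proof
      assume "prob ?A = 0"
      then show ?thesis using AE_iff_measurable[of ?A M "\<lambda>w. w \<notin> ?A"] A
        by (auto simp: emeasure_eq_measure)
    next
      assume "prob ?A = 1"
      then show ?thesis using AE_prob_1[of ?A] A by auto
    qed
    moreover have "AE w in M. \<forall>g. v (act g w) = v w" using inv by (simp add: AE_all_countable)
    ultimately show ?thesis using AE_space by eventually_elim auto
  qed
  then have "AE w in M. \<forall>q. v w > of_rat q \<longleftrightarrow> prob {w \<in> space M. \<forall>g. v (act g w) > of_rat q} = 1"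
    by (simp add: AE_all_countable)
  then have *: "AE w in M. \<forall>q. v w > of_rat q \<longleftrightarrow> P q"
    if "P = (\<lambda>q. prob {w \<in> space M. \<forall>g. v (act g w) > of_rat q} = 1)" for P
    using that by simp
  then obtain P where P: "AE w in M. \<forall>q. v w > of_rat q \<longleftrightarrow> P q" by blast
  \<comment> \<open>The exceptional set is null and cannot exhaust the space; the value of
    \<open>v\<close> at any good point serves as the constant.\<close>
  have "\<exists>w0. \<forall>q. v w0 > of_rat q \<longleftrightarrow> P q"
  proof (rule ccontr)
    assume "\<nexists>w0. \<forall>q. v w0 > of_rat q \<longleftrightarrow> P q"
    then have "AE w in M. False" using eventually_mono[OF P, of "\<lambda>_. False"] by blast
    then show False by (simp add: AE_False)
  qed
  then obtain w0 where w0: "\<forall>q. v w0 > of_rat q \<longleftrightarrow> P q" by blast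
  have "AE w in M. v w = v w0"
    using P
  proof eventually_elim
    case (elim w)
    show ?case
    proof (rule linorder_cases[of "v w" "v w0"])
      assume "v w < v w0"
      then obtain q where "v w < of_rat q" "of_rat q < v w0" using of_rat_dense by blast
      then show ?thesis using elim w0 by (metis less_asym)
    next
      assume "v w0 < v w"
      then obtain q where "v w0 < of_rat q" "of_rat q < v w" using of_rat_dense by blast
      then show ?thesis using elim w0 by (metis less_asym)
    qed
  qed
  then show thesis using that by blast
qed

text \<open>The hull contains functions whose squared \<open>L\<^sup>2\<close> norm is within \<open>\<delta>\<close> of the infimum; by the
parallelogram law two such functions differ by at most \<open>4 \<delta>\<close> in squared norm. Hence a minimising
sequence is Cauchy and asymptotically invariant, and its limit is constant.\<close>

lemma mean_ergodic:
  assumes meas: "\<psi> \<in> borel_measurable M" and b: "\<And>w. \<bar>\<psi> w\<bar> \<le> b"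
    and mean: "(\<integral>w. \<psi> w \<partial>M) = 0" and "\<epsilon> > 0"
  obtains v where "v \<in> mean_hull \<psi>" "(\<integral>w. \<bar>v w\<bar> \<partial>M) < \<epsilon>"
proof -
  have b0: "b \<ge> 0" using b[of undefined] by linarith
  have hm: "u \<in> borel_measurable M" if "u \<in> mean_hull \<psi>" for u
    using hull_measurable[OF meas that] .
  have hb: "\<bar>u w\<bar> \<le> b" if "u \<in> mean_hull \<psi>" for u w using hull_bounded[OF b that] .
  have sqb: "(u w)\<^sup>2 \<le> b\<^sup>2" if "u \<in> mean_hull \<psi>" for u w
    using hb[OF that, of w] b0 abs_le_square_iff[of "u w" b] by simp
  define N where "N u = (\<integral>w. (u w)\<^sup>2 \<partial>M)" for u :: "'w \<Rightarrow> real"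
  have isq: "integrable M (\<lambda>w. (u w)\<^sup>2)" if u: "u \<in> mean_hull \<psi>" for u
    by (rule integrable_bounded[where b = "b\<^sup>2"]) (use hm[OF u] sqb[OF u] in auto)
  define d where "d = Inf (N ` mean_hull \<psi>)"
  have bdd: "bdd_below (N ` mean_hull \<psi>)" by (rule bdd_belowI[of _ 0]) (auto simp: N_def)
  have d: "d \<le> N u" if "u \<in> mean_hull \<psi>" for u
    unfolding d_def by (rule cINF_lower[OF bdd that])
  have close: "(\<integral>w. \<bar>u w - v w\<bar> \<partial>M) \<le> 3 * \<delta>"
    if u: "u \<in> mean_hull \<psi>" "N u \<le> d + \<delta>\<^sup>2" and v: "v \<in> mean_hull \<psi>" "N v \<le> d + \<delta>\<^sup>2" and "\<delta> > 0" for u v \<delta>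
  proof -
    let ?m = "\<lambda>w. (u w + v w) / 2"
    have m: "?m \<in> mean_hull \<psi>" using u v by (intro hull_midpoint)
    have pl: "(u w - v w)\<^sup>2 = 2 * (u w)\<^sup>2 + 2 * (v w)\<^sup>2 - 4 * (?m w)\<^sup>2" for w
      by (simp add: power2_eq_square field_simps)
    have "(\<integral>w. (u w - v w)\<^sup>2 \<partial>M) = 2 * N u + 2 * N v - 4 * N ?m"
      unfolding pl N_def using isq[OF u(1)] isq[OF v(1)] isq[OF m] by simp
    also have "\<dots> \<le> 4 * \<delta>\<^sup>2" using u v d[OF m] by simp
    finally have sq: "(\<integral>w. (u w - v w)\<^sup>2 \<partial>M) \<le> 4 * \<delta>\<^sup>2" .
    have iuv: "integrable M (\<lambda>w. (u w - v w)\<^sup>2)"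
      unfolding pl using isq[OF u(1)] isq[OF v(1)] isq[OF m] by simp
    \<comment> \<open>The elementary bound
      \<open>\<bar>x\<bar> \<le> \<delta> + x\<^sup>2 / (2 * \<delta>)\<close> passes from the
      squared norm to the absolute one; its two terms contribute \<open>\<delta>\<close> and
      \<open>2 * \<delta>\<close>.\<close>
    have "(\<integral>w. \<bar>u w - v w\<bar> \<partial>M) \<le> (\<integral>w. \<delta> + (u w - v w)\<^sup>2 / (2 * \<delta>) \<partial>M)"
    proof (rule integral_mono)
      show "integrable M (\<lambda>w. \<bar>u w - v w\<bar>)"
        using hull_integrable[OF meas b] u v by auto
      show "\<bar>u w - v w\<bar> \<le> \<delta> + (u w - v w)\<^sup>2 / (2 * \<delta>)" for w
      proof -
        have "0 \<le> (\<bar>u w - v w\<bar> - \<delta>)\<^sup>2 + \<delta>\<^sup>2" by simp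
        then have "2 * \<delta> * \<bar>u w - v w\<bar> \<le> 2 * \<delta>\<^sup>2 + (u w - v w)\<^sup>2"
          by (simp add: power2_diff algebra_simps)
        then show ?thesis using \<open>\<delta> > 0\<close> by (simp add: field_simps power2_eq_square)
      qed
    qed (use iuv in auto)
    also have "\<dots> = \<delta> + (\<integral>w. (u w - v w)\<^sup>2 \<partial>M) / (2 * \<delta>)"
      using iuv by (simp add: prob_space)
    also have "\<dots> \<le> \<delta> + 4 * \<delta>\<^sup>2 / (2 * \<delta>)"
      using sq \<open>\<delta> > 0\<close> by (intro add_mono divide_right_mono) auto
    also have "\<dots> = 3 * \<delta>" using \<open>\<delta> > 0\<close> by (simp add: power2_eq_square)
    finally show ?thesis .
  qed
  \<comment> \<open>The tolerance is squared so that \<open>close\<close> applies with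
    \<open>\<delta> = 1 / (n + 1)\<close>.\<close>
  have "\<exists>u. u \<in> mean_hull \<psi> \<and> N u < d + (1 / (real n + 1))\<^sup>2" for n
  proof -
    have "N ` mean_hull \<psi> \<noteq> {}" using hull_base by blast
    moreover have "Inf (N ` mean_hull \<psi>) < d + (1 / (real n + 1))\<^sup>2"
      unfolding d_def[symmetric] by (simp add: zero_less_divide_iff)
    ultimately obtain y where "y \<in> N ` mean_hull \<psi>" "y < d + (1 / (real n + 1))\<^sup>2"
      using cInf_lessD[of "N ` mean_hull \<psi>"] by metis
    then show ?thesis by blast
  qed
  then have "\<exists>s. \<forall>n. s n \<in> mean_hull \<psi> \<and> N (s n) < d + (1 / (real n + 1))\<^sup>2"
    by (rule choice[OF allI])
  then obtain s where s: "\<And>n. s n \<in> mean_hull \<psi>" "\<And>n. N (s n) < d + (1 / (real n + 1))\<^sup>2" by blast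
  note [measurable] = hm[OF s(1)]
  have Ns: "N (s i) \<le> d + (1 / (real n + 1))\<^sup>2" if "n \<le> i" for i n
  proof -
    have "(1 / (real i + 1))\<^sup>2 \<le> (1 / (real n + 1))\<^sup>2"
      using that by (intro power_mono frac_le) auto
    then show ?thesis using s(2)[of i] by linarith
  qed
  have small: "\<exists>n. 3 * (1 / (real n + 1)) < e" if e: "e > 0" for e :: real
  proof -
    obtain n where n: "inverse (real (Suc n)) < e / 3"
      using reals_Archimedean[of "e / 3"] e by auto
    then show ?thesis by (intro exI[of _ n]) (simp add: field_simps)
  qed
  have cauchy: "\<exists>n. \<forall>i\<ge>n. \<forall>j\<ge>n. (\<integral>w. norm (s i w - s j w) \<partial>M) < e" if e: "e > 0" for e :: real
  proof -
    obtain n where "3 * (1 / (real n + 1)) < e" using small[OF e] by blast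
    then have "(\<integral>w. norm (s i w - s j w) \<partial>M) < e" if "n \<le> i" "n \<le> j" for i j
      using close[OF s(1) Ns[OF that(1)] s(1) Ns[OF that(2)]] by simp
    then show ?thesis by blast
  qed
  obtain r where r: "strict_mono r" "AE w in M. Cauchy (\<lambda>i. s (r i) w)"
    using cauchy_L1_AE_cauchy_subseq[OF hull_integrable[OF meas b s(1)] cauchy] by blast
  define v where "v w = lim (\<lambda>i. s (r i) w)" for w
  have [measurable]: "v \<in> borel_measurable M" unfolding v_def by measurable
  have lim: "AE w in M. (\<lambda>i. s (r i) w) \<longlonglongrightarrow> v w"
    using r(2) by eventually_elim (simp add: v_def Cauchy_convergent_iff convergent_LIMSEQ_iff)
  \<comment> \<open>Shifting preserves the hull and the value of \<open>N\<close>, so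
    \<open>close\<close> also compares \<open>s (r i)\<close> with its own shift; dominated
    convergence passes this to the limit.\<close>
  have "AE w in M. v (act g w) = v w" for g
  proof -
    have lim_g: "AE w in M. (\<lambda>i. s (r i) (act g w)) \<longlonglongrightarrow> v (act g w)"
      using AE_act[OF lim] .
    have "(\<lambda>i. \<integral>w. \<bar>s (r i) (act g w) - s (r i) w\<bar> \<partial>M) \<longlonglongrightarrow> (\<integral>w. \<bar>v (act g w) - v w\<bar> \<partial>M)"
    proof (rule integral_dominated_convergence[where w = "\<lambda>_. 2 * b"])
      show "AE w in M. (\<lambda>i. \<bar>s (r i) (act g w) - s (r i) w\<bar>) \<longlonglongrightarrow> \<bar>v (act g w) - v w\<bar>"
        using lim lim_g by eventually_elim (intro tendsto_intros)
      show "AE w in M. norm \<bar>s (r i) (act g w) - s (r i) w\<bar> \<le> 2 * b" for i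
      proof (rule AE_I2)
        show "norm \<bar>s (r i) (act g w) - s (r i) w\<bar> \<le> 2 * b" for w
          using hb[OF s(1), of "r i" "act g w"] hb[OF s(1), of "r i" w] by (simp add: abs_le_iff)
      qed
    qed auto
    moreover have "(\<lambda>i. \<integral>w. \<bar>s (r i) (act g w) - s (r i) w\<bar> \<partial>M) \<longlonglongrightarrow> 0"
    proof (rule LIMSEQ_I)
      fix e :: real assume "e > 0"
      then obtain n where n: "3 * (1 / (real n + 1)) < e" using small by blast
      have "norm ((\<integral>w. \<bar>s (r i) (act g w) - s (r i) w\<bar> \<partial>M) - 0) < e" if "n \<le> i" for i
      proof -
        have i: "n \<le> r i" using that seq_suble[OF r(1), of i] by linarith
        have "N (\<lambda>w. s (r i) (act g w)) = N (s (r i))"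
          unfolding N_def using integral_act[of "\<lambda>w. (s (r i) w)\<^sup>2" g] by simp
        then have "N (\<lambda>w. s (r i) (act g w)) \<le> d + (1 / (real n + 1))\<^sup>2" using Ns[OF i] by simp
        from close[OF hull_shift[OF s(1)] this s(1) Ns[OF i]] n show ?thesis by simp
      qed
      then show "\<exists>n. \<forall>i\<ge>n. norm ((\<integral>w. \<bar>s (r i) (act g w) - s (r i) w\<bar> \<partial>M) - 0) < e" by blast
    qed
    ultimately have "(\<integral>w. \<bar>v (act g w) - v w\<bar> \<partial>M) = 0" by (rule LIMSEQ_unique)
    moreover have "integrable M (\<lambda>w. \<bar>v (act g w) - v w\<bar>)"
    proof (rule integrable_dominated_convergence[where w = "\<lambda>_. 2 * b"])
      show "AE w in M. (\<lambda>i. \<bar>s (r i) (act g w) - s (r i) w\<bar>) \<longlonglongrightarrow> \<bar>v (act g w) - v w\<bar>"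
        using lim lim_g by eventually_elim (intro tendsto_intros)
      show "AE w in M. norm \<bar>s (r i) (act g w) - s (r i) w\<bar> \<le> 2 * b" for i
      proof (rule AE_I2)
        show "norm \<bar>s (r i) (act g w) - s (r i) w\<bar> \<le> 2 * b" for w
          using hb[OF s(1), of "r i" "act g w"] hb[OF s(1), of "r i" w] by (simp add: abs_le_iff)
      qed
    qed auto
    ultimately show ?thesis by (simp add: integral_nonneg_eq_0_iff_AE)
  qed
  then obtain c where c: "AE w in M. v w = c" by (rule invariant_AE_const[rotated]) measurable
  have "(\<lambda>i. \<integral>w. s (r i) w \<partial>M) \<longlonglongrightarrow> (\<integral>w. v w \<partial>M)"
    by (rule integral_dominated_convergence[where w = "\<lambda>_. b"]) (use lim hb[OF s(1)] in auto)
  then have "(\<integral>w. v w \<partial>M) = 0"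
    using hull_integral[OF meas b s(1)] by (simp add: mean LIMSEQ_const_iff)
  moreover have "(\<integral>w. v w \<partial>M) = (\<integral>w. c \<partial>M)" by (rule integral_cong_AE) (use c in auto)
  ultimately have "c = 0" by (simp add: prob_space)
  have "(\<lambda>i. \<integral>w. \<bar>s (r i) w\<bar> \<partial>M) \<longlonglongrightarrow> (\<integral>w. \<bar>c\<bar> \<partial>M)"
  proof (rule integral_dominated_convergence[where w = "\<lambda>_. b"])
    show "AE w in M. (\<lambda>i. \<bar>s (r i) w\<bar>) \<longlonglongrightarrow> \<bar>c\<bar>"
      using lim c by eventually_elim (auto intro: tendsto_intros)
  qed (use hb[OF s(1)] in auto)
  then have "(\<lambda>i. \<integral>w. \<bar>s (r i) w\<bar> \<partial>M) \<longlonglongrightarrow> 0" using \<open>c = 0\<close> by simp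
  then have "\<forall>\<^sub>F i in sequentially. (\<integral>w. \<bar>s (r i) w\<bar> \<partial>M) < \<epsilon>"
    using \<open>\<epsilon> > 0\<close> by (rule order_tendstoD)
  then obtain i where "(\<integral>w. \<bar>s (r i) w\<bar> \<partial>M) < \<epsilon>" by (auto simp: eventually_sequentially)
  then show thesis using that s(1) by blast
qed

text \<open>The points whose averages fail to stay below \<open>r\<close> eventually also fail for
  every hull element \<open>v\<close> at level \<open>r / 2\<close>. The maximal inequality bounds
  their probability by a fixed multiple of the integral of the absolute value of \<open>v\<close>,
  which \<open>mean_ergodic\<close> makes arbitrarily small.\<close>

lemma pointwise_ergodic_centred:
  fixes F :: "nat \<Rightarrow> 'g set"
  assumes F: "tempered_folner_seq F"
    and meas [measurable]: "\<psi> \<in> borel_measurable M" and b: "\<And>w. \<bar>\<psi> w\<bar> \<le> b"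
    and mean: "(\<integral>w. \<psi> w \<partial>M) = 0"
  shows "AE w in M. (\<lambda>k. ave (F k) \<psi> w) \<longlonglongrightarrow> 0"
proof -
  obtain C :: real where F': "folner_seq F"
    and C: "\<And>k. card (set_prod (\<Union>j<k. set_inv (F j)) (F k)) \<le> C * card (F k)"
    using F by (auto simp: tempered_folner_seq_def)
  have "AE w in M. \<forall>\<^sub>F k in sequentially. \<bar>ave (F k) \<psi> w\<bar> < r" if "r > 0" for r :: real
  proof -
    let ?Bad = "{w \<in> space M. \<not> (\<exists>N. \<forall>k\<ge>N. \<bar>ave (F k) \<psi> w\<bar> < r)}"
    have [measurable]: "?Bad \<in> sets M" by measurable
    \<comment> \<open>One half of \<open>r\<close> is for the averages of \<open>v\<close>, the
      other for their vanishing distance from those of \<open>\<psi>\<close>.\<close>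
    define c where "c = 2 * (1 + C) / (r / 2)"
    have le: "prob ?Bad \<le> c * (\<integral>w. \<bar>v w\<bar> \<partial>M)" if v: "v \<in> mean_hull \<psi>" for v
    proof -
      have [measurable]: "v \<in> borel_measurable M" by (rule hull_measurable[OF meas v])
      have "prob ?Bad \<le> prob {w \<in> space M. \<exists>k. ave (F k) (\<lambda>w. \<bar>v w\<bar>) w \<ge> r / 2}"
      proof (rule finite_measure_mono)
        show "?Bad \<subseteq> {w \<in> space M. \<exists>k. ave (F k) (\<lambda>w. \<bar>v w\<bar>) w \<ge> r / 2}"
        proof (rule subsetI, rule ccontr)
          fix w assume w: "w \<in> ?Bad" and "w \<notin> {w \<in> space M. \<exists>k. ave (F k) (\<lambda>w. \<bar>v w\<bar>) w \<ge> r / 2}"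
          then have lt: "ave (F k) (\<lambda>w. \<bar>v w\<bar>) w < r / 2" for k by (auto simp: not_le)
          have "\<bar>ave (F k) v w\<bar> \<le> ave (F k) (\<lambda>w. \<bar>v w\<bar>) w" for k
            by (simp add: ave_def divide_right_mono)
          with lt have lt: "\<bar>ave (F k) v w\<bar> < r / 2" for k using le_less_trans by blast
          have "\<forall>\<^sub>F k in sequentially. dist (ave (F k) v w - ave (F k) \<psi> w) 0 < r / 2"
            using ave_hull[OF F' b _ v, of w] w \<open>r > 0\<close> by (intro tendstoD) auto
          then have "\<forall>\<^sub>F k in sequentially. \<bar>ave (F k) \<psi> w\<bar> < r"
          proof eventually_elim
            case (elim k)
            then have "\<bar>ave (F k) v w - ave (F k) \<psi> w\<bar> < r / 2" by (simp only: dist_real_def diff_zero)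
            then show ?case using lt[of k] by linarith
          qed
          then show False using w by (auto simp: eventually_sequentially)
        qed
      qed measurable
      also have "\<dots> \<le> c * (\<integral>w. \<bar>v w\<bar> \<partial>M)"
        unfolding c_def using hull_integrable[OF meas b v] \<open>r > 0\<close> by (intro maximal_inequality[OF F' C]) auto
      finally show ?thesis .
    qed
    have "prob ?Bad \<le> 0"
    proof (rule field_le_epsilon)
      fix e :: real assume "e > 0"
      \<comment> \<open>Dividing by \<open>\<bar>c\<bar> + 1\<close> is safe whatever the value of
        \<open>c\<close>.\<close>
      have "0 < e / (\<bar>c\<bar> + 1)" using \<open>e > 0\<close> by (simp add: add_nonneg_pos)
      then obtain v where v: "v \<in> mean_hull \<psi>" "(\<integral>w. \<bar>v w\<bar> \<partial>M) < e / (\<bar>c\<bar> + 1)"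
        using mean_ergodic[OF meas b mean] by blast
      have "prob ?Bad \<le> c * (\<integral>w. \<bar>v w\<bar> \<partial>M)" by (rule le[OF v(1)])
      also have "\<dots> \<le> (\<bar>c\<bar> + 1) * (\<integral>w. \<bar>v w\<bar> \<partial>M)" by (intro mult_right_mono) auto
      also have "\<dots> \<le> (\<bar>c\<bar> + 1) * (e / (\<bar>c\<bar> + 1))" using v(2) by (intro mult_left_mono) auto
      also have "\<dots> = e" by (simp add: add_nonneg_eq_0_iff)
      finally show "prob ?Bad \<le> 0 + e" by simp
    qed
    then have "prob ?Bad = 0" by (simp add: measure_le_0_iff)
    then have "AE w in M. w \<notin> ?Bad"
      by (intro AE_I[of _ _ ?Bad]) (auto simp: emeasure_eq_measure)
    then show ?thesis
      using AE_space by eventually_elim (auto simp: eventually_sequentially)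
  qed
  then have "AE w in M. \<forall>m. \<forall>\<^sub>F k in sequentially. \<bar>ave (F k) \<psi> w\<bar> < inverse (real (Suc m))"
    by (simp add: AE_all_countable)
  then show ?thesis
  proof eventually_elim
    case (elim w)
    show ?case
    proof (rule tendstoI)
      fix e :: real assume "e > 0"
      then obtain m where m: "inverse (real (Suc m)) < e"
        using reals_Archimedean by blast
      show "\<forall>\<^sub>F k in sequentially. dist (ave (F k) \<psi> w) 0 < e"
        using elim[rule_format, of m] m by (auto elim!: eventually_mono)
    qed
  qed
qed

text \<open>The centred case applied to \<open>\<phi>\<close> minus its mean. Boundedness is no
  obstacle later, because the information of a finite window takes finitely many values.\<close>

theorem pointwise_ergodic:
  fixes F :: "nat \<Rightarrow> 'g set"
  assumes F: "tempered_folner_seq F"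
    and meas: "\<phi> \<in> borel_measurable M" and b: "\<And>w. \<bar>\<phi> w\<bar> \<le> b"
  shows "AE w in M. (\<lambda>k. ave (F k) \<phi> w) \<longlonglongrightarrow> (\<integral>w. \<phi> w \<partial>M)"
proof -
  let ?I = "\<integral>w. \<phi> w \<partial>M"
  have int: "integrable M \<phi>" by (rule integrable_bounded[OF meas b])
  have F': "folner_seq F" using F by (simp add: tempered_folner_seq_def)
  have "AE w in M. (\<lambda>k. ave (F k) (\<lambda>w. \<phi> w - ?I) w) \<longlonglongrightarrow> 0"
  proof (rule pointwise_ergodic_centred[OF F])
    show "\<bar>\<phi> w - ?I\<bar> \<le> b + \<bar>?I\<bar>" for w using b[of w] by linarith
    show "(\<integral>w. \<phi> w - ?I \<partial>M) = 0" using int by (simp add: prob_space)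
  qed (use meas in simp)
  moreover have "ave (F k) (\<lambda>w. \<phi> w - ?I) w = ave (F k) \<phi> w - ?I" for k w
    using folner_seq_card_pos[OF F', of k]
    by (simp add: ave_def sum_subtractf diff_divide_distrib)
  ultimately show ?thesis by (simp add: LIM_zero_iff)
qed

end

section \<open>A Finner-type inequality\<close>

text \<open>The arithmetic-geometric mean inequality for \<open>m\<close> numbers, where the missing
  \<open>m - card J\<close> ones are set to 1. It follows from \<open>ln x \<le> x - 1\<close> at
  each \<open>u i / A\<close> and, for the padding, at \<open>1 / A\<close>, with \<open>A\<close>
  the padded mean.\<close>

lemma am_gm_powr:
  fixes u :: "'i \<Rightarrow> real"
  assumes "finite J" "card J \<le> m" "m > 0" and nonneg: "\<And>i. i \<in> J \<Longrightarrow> u i \<ge> 0"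
  shows "(\<Prod>i\<in>J. u i powr (1 / real m)) \<le> ((\<Sum>i\<in>J. u i) + (real m - real (card J))) / real m"
proof (cases "\<exists>i\<in>J. u i = 0")
  case True
  then have eq: "(\<Prod>i\<in>J. u i powr (1 / real m)) = 0" using \<open>finite J\<close> by (auto intro: prod_zero)
  show ?thesis unfolding eq using assms by (simp add: sum_nonneg)
next
  case False
  with nonneg have pos: "\<And>i. i \<in> J \<Longrightarrow> u i > 0" by force
  then have nz: "\<And>i. i \<in> J \<Longrightarrow> u i \<noteq> 0" by force
  define A where "A = ((\<Sum>i\<in>J. u i) + (real m - real (card J))) / real m"
  have "A > 0"
  proof (cases "J = {}")
    case True
    then show ?thesis using \<open>m > 0\<close> by (simp add: A_def)
  next
    case False
    then have "(\<Sum>i\<in>J. u i) > 0" using pos \<open>finite J\<close> by (intro sum_pos) auto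
    then show ?thesis using assms by (simp add: A_def add_pos_nonneg)
  qed
  have 1: "ln (u i) - ln A \<le> u i / A - 1" if "i \<in> J" for i
    using ln_le_minus_one[of "u i / A"] pos[OF that] \<open>A > 0\<close> by (simp add: ln_div)
  have 2: "- ln A \<le> 1 / A - 1"
    using ln_le_minus_one[of "1 / A"] \<open>A > 0\<close> by (simp add: ln_div)
  have "(\<Sum>i\<in>J. ln (u i)) - m * ln A = (\<Sum>i\<in>J. ln (u i) - ln A) + (real m - card J) * (- ln A)"
    by (simp add: sum_subtractf algebra_simps)
  also have "\<dots> \<le> (\<Sum>i\<in>J. u i / A - 1) + (real m - card J) * (1 / A - 1)"
    using 1 2 assms by (intro add_mono sum_mono mult_left_mono) auto
  also have "\<dots> = ((\<Sum>i\<in>J. u i) + (real m - real (card J))) / A - m"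
    using \<open>A > 0\<close> by (simp add: sum_subtractf sum_divide_distrib[symmetric] field_simps)
  also have "\<dots> = 0" using \<open>A > 0\<close> \<open>m > 0\<close> by (simp add: A_def field_simps)
  finally have le: "(\<Sum>i\<in>J. ln (u i)) / m \<le> ln A" using \<open>m > 0\<close> by (simp add: field_simps)
  have "(\<Prod>i\<in>J. u i powr (1 / real m)) = (\<Prod>i\<in>J. exp (ln (u i) / m))"
    by (intro prod.cong refl) (simp add: powr_def nz)
  also have "\<dots> = exp ((\<Sum>i\<in>J. ln (u i)) / m)"
    using \<open>finite J\<close> by (simp add: exp_sum sum_divide_distrib)
  also have "\<dots> \<le> exp (ln A)" using le by simp
  finally show ?thesis using \<open>A > 0\<close> by (simp add: A_def)
qed

text \<open>Hoelder's inequality with equal exponents on the uniform alphabet. Each function is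
  divided by its average \<open>E i\<close>; AM-GM holds letter by letter, and the normalised
  functions average to 1.\<close>

lemma holder_average:
  fixes h :: "'i \<Rightarrow> 's::finite \<Rightarrow> real"
  assumes J: "finite J" "card J \<le> m" "m > 0" and nonneg: "\<And>i s. h i s \<ge> 0"
  shows "(\<Sum>s\<in>UNIV. \<Prod>i\<in>J. h i s powr (1 / real m)) / CARD('s)
    \<le> (\<Prod>i\<in>J. ((\<Sum>s\<in>UNIV. h i s) / CARD('s)) powr (1 / real m))"
proof (cases "\<exists>i\<in>J. (\<Sum>s\<in>UNIV. h i s) = 0")
  case True
  then obtain i where i: "i \<in> J" "\<And>s. h i s = 0" using nonneg by (auto simp: sum_nonneg_eq_0_iff)
  then have "(\<Prod>i\<in>J. h i s powr (1 / real m)) = 0" for s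
    using J(1) by (intro prod_zero bexI[of _ i]) auto
  then show ?thesis by (simp add: prod_nonneg)
next
  case False
  define E where "E i = (\<Sum>s\<in>UNIV. h i s) / CARD('s)" for i
  have E: "E i > 0" if "i \<in> J" for i
    using False that nonneg by (simp add: E_def sum_nonneg less_le)
  then have E0: "E i \<noteq> 0" if "i \<in> J" for i using that by force
  define P where "P = (\<Prod>i\<in>J. E i powr (1 / real m))"
  have P: "P > 0" unfolding P_def by (intro prod_pos) (simp add: E0)
  have "(\<Prod>i\<in>J. h i s powr (1 / real m))
    \<le> P * (((\<Sum>i\<in>J. h i s / E i) + (real m - real (card J))) / real m)" for s
  proof -
    have "(\<Prod>i\<in>J. h i s powr (1 / real m)) = P * (\<Prod>i\<in>J. (h i s / E i) powr (1 / real m))"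
      unfolding P_def prod.distrib[symmetric]
      by (intro prod.cong refl) (simp add: powr_divide less_imp_le nonneg E E0)
    also have "\<dots> \<le> P * (((\<Sum>i\<in>J. h i s / E i) + (real m - real (card J))) / real m)"
      using P by (intro mult_left_mono am_gm_powr J) (auto intro!: divide_nonneg_pos nonneg E)
    finally show ?thesis .
  qed
  then have "(\<Sum>s\<in>UNIV. \<Prod>i\<in>J. h i s powr (1 / real m))
    \<le> (\<Sum>s\<in>(UNIV :: 's set). P * (((\<Sum>i\<in>J. h i s / E i) + (real m - real (card J))) / real m))"
    by (rule sum_mono)
  also have "\<dots> = P * (((\<Sum>s\<in>(UNIV :: 's set). \<Sum>i\<in>J. h i s / E i)
      + CARD('s) * (real m - real (card J))) / real m)"
    by (simp add: sum_distrib_left[symmetric] sum_divide_distrib[symmetric] sum.distrib)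
  also have "(\<Sum>s\<in>(UNIV :: 's set). \<Sum>i\<in>J. h i s / E i)
      = (\<Sum>i\<in>J. (\<Sum>s\<in>(UNIV :: 's set). h i s) / E i)"
    by (subst sum.swap) (simp add: sum_divide_distrib)
  also have "(\<Sum>i\<in>J. (\<Sum>s\<in>(UNIV :: 's set). h i s) / E i) = (\<Sum>i\<in>J. real CARD('s))"
    by (intro sum.cong refl) (use False in \<open>simp add: E_def\<close>)
  finally have "(\<Sum>s\<in>UNIV. \<Prod>i\<in>J. h i s powr (1 / real m)) \<le> P * CARD('s)"
    using \<open>m > 0\<close> by (simp add: algebra_simps)
  then show ?thesis by (simp add: P_def E_def field_simps)
qed

section \<open>Uniform averages over configurations, Finner's inequality and a Kraft bound\<close>

definition uavg :: "'v set \<Rightarrow> (('v \<Rightarrow> 's::finite) \<Rightarrow> real) \<Rightarrow> real" where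
  "uavg V f = (\<Sum>p\<in>PiE V (\<lambda>_. UNIV). f p) / real CARD('s) ^ card V"

definition depends_on :: "'v set \<Rightarrow> (('v \<Rightarrow> 's) \<Rightarrow> 'a) \<Rightarrow> bool" where
  "depends_on S f \<longleftrightarrow> (\<forall>p q. (\<forall>v\<in>S. p v = q v) \<longrightarrow> f p = f q)"

lemma depends_onI: "(\<And>p q. (\<And>v. v \<in> S \<Longrightarrow> p v = q v) \<Longrightarrow> f p = f q) \<Longrightarrow> depends_on S f"
  and depends_onD: "depends_on S f \<Longrightarrow> (\<And>v. v \<in> S \<Longrightarrow> p v = q v) \<Longrightarrow> f p = f q"
  unfolding depends_on_def by blast+

lemma depends_on_upd: "depends_on S f \<Longrightarrow> depends_on S (\<lambda>p. f (p(v := s)))"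
  by (rule depends_onI, erule depends_onD) simp

lemma depends_on_upd_eq: "depends_on S f \<Longrightarrow> v \<notin> S \<Longrightarrow> f (p(v := s)) = f p"
  by (erule depends_onD) auto

lemma uavg_nonneg: "(\<And>p. f p \<ge> 0) \<Longrightarrow> uavg V f \<ge> 0"
  by (simp add: uavg_def sum_nonneg)

lemma uavg_insert:
  fixes f :: "('v \<Rightarrow> 's::finite) \<Rightarrow> real"
  assumes "finite V" "v \<notin> V"
  shows "uavg (insert v V) f = (\<Sum>s\<in>UNIV. uavg V (\<lambda>p. f (p(v := s)))) / CARD('s)"
proof -
  have "(\<Sum>p\<in>PiE (insert v V) (\<lambda>_. UNIV). f p)
      = (\<Sum>(s, p)\<in>UNIV \<times> PiE V (\<lambda>_. UNIV). f (p(v := s)))"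
    unfolding PiE_insert_eq using inj_combinator[OF \<open>v \<notin> V\<close>]
    by (subst sum.reindex) (auto simp: case_prod_unfold)
  then show ?thesis
    using assms by (simp add: uavg_def sum.cartesian_product sum_divide_distrib[symmetric] mult.commute)
qed

lemma uavg_restrict:
  fixes f :: "('v \<Rightarrow> 's::finite) \<Rightarrow> real"
  assumes "finite V" "S \<subseteq> V" and f: "depends_on S f"
  shows "uavg V f = uavg S f"
proof -
  have "uavg (S \<union> D) f = uavg S f" if "finite D" "D \<inter> S = {}" for D
    using that
  proof induction
    case (insert v D)
    have "uavg (insert v (S \<union> D)) f = (\<Sum>s\<in>(UNIV::'s set). uavg (S \<union> D) f) / CARD('s)"
      using insert finite_subset[OF \<open>S \<subseteq> V\<close> \<open>finite V\<close>]
      by (subst uavg_insert) (auto simp: depends_on_upd_eq[OF f])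
    then show ?case using insert by simp
  qed simp
  moreover have "(V - S) \<inter> S = {}" "S \<union> (V - S) = V" using \<open>S \<subseteq> V\<close> by auto
  ultimately show ?thesis using \<open>finite V\<close> by (metis finite_Diff)
qed

text \<open>Induction on the coordinates. With the letter at \<open>v\<close> fixed, the induction
  hypothesis handles the remaining coordinates. On averaging over that letter, the at most
  \<open>m\<close> factors that read \<open>v\<close> are combined by \<open>holder_average\<close>,
  and the others come out as constants.\<close>

lemma finner:
  fixes G :: "'i \<Rightarrow> ('v \<Rightarrow> 's::finite) \<Rightarrow> real"
  assumes "finite V" "finite I" "m > 0"
    and "\<And>v. v \<in> V \<Longrightarrow> card {i \<in> I. v \<in> S i} \<le> m"
    and "\<And>i p. G i p \<ge> 0" "\<And>i. depends_on (S i) (G i)"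
  shows "uavg V (\<lambda>p. \<Prod>i\<in>I. G i p powr (1 / real m)) \<le> (\<Prod>i\<in>I. uavg V (G i) powr (1 / real m))"
  using assms(1,4-)
proof (induction V arbitrary: G rule: finite_induct)
  case empty
  then show ?case by (simp add: uavg_def)
next
  case (insert v V)
  let ?e = "\<lambda>i s. uavg V (\<lambda>p. G i (p(v := s)))"
  let ?J = "{i \<in> I. v \<in> S i}" and ?K = "{i \<in> I. v \<notin> S i}"
  have split: "prod f I = prod f ?J * prod f ?K" for f :: "'i \<Rightarrow> real"
    using \<open>finite I\<close> by (subst prod.union_disjoint[symmetric]) (auto intro: prod.cong)
  have e: "uavg (insert v V) (G i) = (\<Sum>s\<in>UNIV. ?e i s) / CARD('s)" for i
    by (rule uavg_insert[OF insert.hyps])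
  have eK: "?e i s = uavg (insert v V) (G i)" if "i \<in> ?K" for i s
    using that by (simp add: e depends_on_upd_eq[OF insert.prems(3)])
  have "uavg (insert v V) (\<lambda>p. \<Prod>i\<in>I. G i p powr (1 / real m))
    = (\<Sum>s\<in>UNIV. uavg V (\<lambda>p. \<Prod>i\<in>I. G i (p(v := s)) powr (1 / real m))) / CARD('s)"
    by (rule uavg_insert[OF insert.hyps])
  also have "\<dots> \<le> (\<Sum>s\<in>UNIV. \<Prod>i\<in>I. ?e i s powr (1 / real m)) / CARD('s)"
  proof (intro divide_right_mono sum_mono insert.IH)
    show "depends_on (S i) (\<lambda>p. G i (p(v := s)))" for i s
      by (rule depends_on_upd[OF insert.prems(3)])
  qed (use insert.prems in auto)
  also have "(\<Sum>s\<in>UNIV. \<Prod>i\<in>I. ?e i s powr (1 / real m))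
      = (\<Sum>s\<in>UNIV. (\<Prod>i\<in>?J. ?e i s powr (1 / real m))
        * (\<Prod>i\<in>?K. uavg (insert v V) (G i) powr (1 / real m)))"
    unfolding split by (intro sum.cong refl arg_cong2[where f = times] prod.cong) (simp only: eK)
  also have "\<dots> / CARD('s) = (\<Sum>s\<in>UNIV. (\<Prod>i\<in>?J. ?e i s powr (1 / real m))) / CARD('s)
      * (\<Prod>i\<in>?K. uavg (insert v V) (G i) powr (1 / real m))"
    by (simp add: sum_distrib_right)
  also have "\<dots> \<le> (\<Prod>i\<in>?J. ((\<Sum>s\<in>UNIV. ?e i s) / CARD('s)) powr (1 / real m))
      * (\<Prod>i\<in>?K. uavg (insert v V) (G i) powr (1 / real m))"
    using \<open>finite I\<close> \<open>m > 0\<close> insert.prems(1,2)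
    by (intro mult_right_mono holder_average uavg_nonneg) (auto intro: prod_nonneg)
  finally show ?case unfolding split e .
qed

text \<open>Every point of \<open>T + A T\<close> lies in at most \<open>|A|\<close> of the windows \<open>A f\<close>, \<open>f \<in> T\<close>, so the
\<open>|A|\<close>-th roots of a probability weight \<open>q\<close>, read through these windows, satisfy a Kraft inequality
up to a factor which counts the coordinates outside \<open>T\<close>.\<close>

lemma window_kraft:
  fixes q :: "('g::group_add \<Rightarrow> 's::finite) \<Rightarrow> real"
  assumes A: "finite A" "A \<noteq> {}" and T: "finite T"
    and q: "\<And>p. q p \<ge> 0" "(\<Sum>p\<in>PiE A (\<lambda>_. UNIV). q p) \<le> 1"
  shows "(\<Sum>y\<in>PiE (T \<union> set_prod A T) (\<lambda>_. UNIV).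
      \<Prod>f\<in>T. q (\<lambda>a\<in>A. y (a + f)) powr (1 / card A))
    \<le> real CARD('s) ^ card (set_prod A T - T)"
proof -
  let ?V = "T \<union> set_prod A T" and ?m = "card A" and ?S = "real CARD('s)"
  define G where "G f y = q (\<lambda>a\<in>A. y (a + f))" for f y
  have G0: "G f y \<ge> 0" for f y by (simp add: G_def q)
  have m: "?m > 0" using A by (simp add: card_gt_0_iff)
  have dep: "depends_on (translate_right A f) (G f)" for f
    unfolding G_def
  proof (rule depends_onI)
    fix y z :: "'g \<Rightarrow> 's" assume "\<And>v. v \<in> translate_right A f \<Longrightarrow> y v = z v"
    then have "(\<lambda>a\<in>A. y (a + f)) = (\<lambda>a\<in>A. z (a + f))"
      by (auto simp: translate_right_def restrict_def)
    then show "q (\<lambda>a\<in>A. y (a + f)) = q (\<lambda>a\<in>A. z (a + f))" by simp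
  qed
  \<comment> \<open>Coordinates outside the window average out, and those inside are identified with
    \<open>A\<close>, so the sum is the total mass of \<open>q\<close>.\<close>
  have uG: "uavg ?V (G f) \<le> 1 / ?S ^ ?m" if f: "f \<in> T" for f
  proof -
    have "uavg ?V (G f) = uavg (translate_right A f) (G f)"
      using A T f dep by (intro uavg_restrict) (auto simp: set_prod_translate_right)
    also have "(\<Sum>p\<in>PiE (translate_right A f) (\<lambda>_. UNIV). G f p) = (\<Sum>p\<in>PiE A (\<lambda>_. UNIV). q p)"
      unfolding G_def
      by (rule sum.reindex_bij_witness[where j = "\<lambda>y. \<lambda>a\<in>A. y (a + f)"
            and i = "\<lambda>p. \<lambda>v\<in>translate_right A f. p (v - f)"])
        (auto simp: mem_translate_right_iff translate_right_def PiE_def extensional_def fun_eq_iff)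
    then have "uavg (translate_right A f) (G f) = (\<Sum>p\<in>PiE A (\<lambda>_. UNIV). q p) / ?S ^ ?m"
      by (simp add: uavg_def)
    also have "\<dots> \<le> 1 / ?S ^ ?m" using q(2) by (intro divide_right_mono) auto
    finally show ?thesis .
  qed
  have cardV: "card ?V = card T + card (set_prod A T - T)"
    using A T by (subst card_Un_disjoint[symmetric]) auto
  have "uavg ?V (\<lambda>p. \<Prod>f\<in>T. G f p powr (1 / ?m)) \<le> (\<Prod>f\<in>T. uavg ?V (G f) powr (1 / ?m))"
  proof (rule finner[where S = "translate_right A"])
    show "card {f \<in> T. v \<in> translate_right A f} \<le> ?m" for v
      by (rule card_covering_translates_le[OF A(1)])
  qed (use A T m dep G0 in auto)
  also have "\<dots> \<le> (\<Prod>f\<in>T. (1 / ?S ^ ?m) powr (1 / ?m))"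
    using uG G0 by (intro prod_mono conjI powr_mono2) (auto intro: uavg_nonneg)
  also have "(1 / ?S ^ ?m) powr (1 / ?m) = 1 / ?S"
    using m by (simp add: powr_divide powr_powr flip: powr_realpow)
  \<comment> \<open>Each \<open>f\<close> in \<open>T\<close> contributes one factor
    \<open>1 / ?S\<close>. Against the normalisation \<open>?S ^ card ?V\<close> this leaves one
    factor \<open>?S\<close> per coordinate outside \<open>T\<close>.\<close>
  finally have "(\<Sum>y\<in>PiE ?V (\<lambda>_. UNIV). \<Prod>f\<in>T. G f y powr (1 / ?m)) / ?S ^ card ?V \<le> 1 / ?S ^ card T"
    by (simp add: uavg_def power_divide)
  then show ?thesis
    unfolding cardV G_def by (simp add: power_add field_simps)
qed

text \<open>Markov's inequality for the Kraft sum of \<open>window_kraft\<close>.\<close>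

lemma card_likely_configurations_le:
  fixes q :: "('g::group_add \<Rightarrow> 's::finite) \<Rightarrow> real"
  assumes A: "finite A" "A \<noteq> {}" and T: "finite T"
    and q: "\<And>p. q p \<ge> 0" "(\<Sum>p\<in>PiE A (\<lambda>_. UNIV). q p) \<le> 1" and "t > 0"
  shows "card {y \<in> PiE (T \<union> set_prod A T) (\<lambda>_. UNIV).
      t \<le> (\<Prod>f\<in>T. q (\<lambda>a\<in>A. y (a + f)) powr (1 / card A))}
    \<le> real CARD('s) ^ card (set_prod A T - T) / t"
proof -
  let ?Y = "PiE (T \<union> set_prod A T) (\<lambda>_. UNIV) :: ('g \<Rightarrow> 's) set"
  let ?p = "\<lambda>y. \<Prod>f\<in>T. q (\<lambda>a\<in>A. y (a + f)) powr (1 / card A)"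
  have fin: "finite ?Y" using A T by (intro finite_PiE) auto
  have "t * card {y \<in> ?Y. t \<le> ?p y} = (\<Sum>y\<in>{y \<in> ?Y. t \<le> ?p y}. t)" by simp
  also have "\<dots> \<le> (\<Sum>y\<in>{y \<in> ?Y. t \<le> ?p y}. ?p y)" by (intro sum_mono) auto
  also have "\<dots> \<le> (\<Sum>y\<in>?Y. ?p y)" using fin by (intro sum_mono2) (auto intro: prod_nonneg)
  also have "\<dots> \<le> real CARD('s) ^ card (set_prod A T - T)" by (rule window_kraft[OF A T q])
  finally show ?thesis using \<open>t > 0\<close> by (simp add: field_simps)
qed

section \<open>Typical names of a process\<close>

context ergodic_action
begin

context
  fixes X :: "'w \<Rightarrow> 's::finite"
  assumes X [measurable]: "X \<in> measurable M (count_space UNIV)"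
begin

definition name :: "'g set \<Rightarrow> 'w \<Rightarrow> 'g \<Rightarrow> 's" where
  "name A w = (\<lambda>g\<in>A. X (act g w))"

definition cyl :: "'g set \<Rightarrow> ('g \<Rightarrow> 's) \<Rightarrow> 'w set" where
  "cyl A p = {w \<in> space M. \<forall>g\<in>A. X (act g w) = p g}"

text \<open>The information function of the partition into \<open>A\<close>-names. Its mean is the
  block entropy, which makes entropy accessible to the ergodic theorem.\<close>

definition info :: "'g set \<Rightarrow> 'w \<Rightarrow> real" where
  "info A w = - log 2 (prob (cyl A (name A w)))"

lemma cyl_sets [measurable]: "cyl A p \<in> sets M"
  unfolding cyl_def by measurable

lemma name_PiE [simp]: "name A w \<in> PiE A (\<lambda>_. UNIV)"
  by (simp add: name_def)

lemma mem_cyl_iff: "w \<in> space M \<Longrightarrow> p \<in> PiE A (\<lambda>_. UNIV) \<Longrightarrow> w \<in> cyl A p \<longleftrightarrow> p = name A w"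
  by (auto simp: cyl_def name_def PiE_def intro: extensionalityI)

lemma sum_prob_cyl:
  assumes "finite A"
  shows "(\<Sum>p\<in>PiE A (\<lambda>_. UNIV). prob (cyl A p)) = 1"
proof -
  have "prob (\<Union>p\<in>PiE A (\<lambda>_. UNIV). cyl A p) = (\<Sum>p\<in>PiE A (\<lambda>_. UNIV). prob (cyl A p))"
  proof (rule finite_measure_finite_Union)
    show "disjoint_family_on (cyl A) (PiE A (\<lambda>_. UNIV))"
      unfolding disjoint_family_on_def
    proof (intro ballI impI)
      fix p q :: "'g \<Rightarrow> 's"
      assume pq: "p \<in> PiE A (\<lambda>_. UNIV)" "q \<in> PiE A (\<lambda>_. UNIV)" "p \<noteq> q"
      have "cyl A p \<subseteq> space M" by (auto simp: cyl_def)
      then show "cyl A p \<inter> cyl A q = {}"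
        using mem_cyl_iff[OF _ pq(1)] mem_cyl_iff[OF _ pq(2)] pq(3) by (auto simp: subset_iff)
    qed
  qed (use assms in \<open>auto intro: finite_PiE\<close>)
  moreover have "(\<Union>p\<in>PiE A (\<lambda>_. UNIV). cyl A p) = space M"
  proof
    show "space M \<subseteq> (\<Union>p\<in>PiE A (\<lambda>_. UNIV). cyl A p)"
    proof
      fix w assume "w \<in> space M"
      then have "w \<in> cyl A (name A w)" by (simp add: mem_cyl_iff)
      then show "w \<in> (\<Union>p\<in>PiE A (\<lambda>_. UNIV). cyl A p)" by (rule UN_I[OF name_PiE])
    qed
  qed (auto simp: cyl_def)
  ultimately show ?thesis by (simp add: prob_space)
qed

lemma info_eq_sum:
  assumes "finite A" "w \<in> space M"
  shows "info A w = (\<Sum>p\<in>PiE A (\<lambda>_. UNIV). - log 2 (prob (cyl A p)) * indicator (cyl A p) w)"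
proof -
  have "(\<Sum>p\<in>PiE A (\<lambda>_. UNIV). - log 2 (prob (cyl A p)) * indicator (cyl A p) w)
    = (\<Sum>p\<in>PiE A (\<lambda>_. UNIV). if p = name A w then - log 2 (prob (cyl A p)) else 0)"
    by (intro sum.cong refl) (simp add: mem_cyl_iff[OF assms(2)] indicator_def)
  also have "\<dots> = info A w"
    using assms(1) by (simp add: info_def finite_PiE)
  finally show ?thesis by simp
qed

lemma info_measurable:
  assumes "finite A"
  shows "info A \<in> borel_measurable M"
proof -
  have "(\<lambda>w. \<Sum>p\<in>PiE A (\<lambda>_. UNIV). - log 2 (prob (cyl A p)) * indicator (cyl A p) w)
      \<in> borel_measurable M"
    by (intro borel_measurable_sum borel_measurable_times borel_measurable_const
        borel_measurable_indicator cyl_sets)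
  then show ?thesis by (simp only: measurable_cong[OF info_eq_sum[OF assms]])
qed

lemma info_bounded:
  assumes "finite A"
  shows "\<bar>info A w\<bar> \<le> (\<Sum>p\<in>PiE A (\<lambda>_. UNIV). \<bar>log 2 (prob (cyl A p))\<bar>)"
  unfolding info_def abs_minus_cancel
  by (rule member_le_sum[of "name A w" _ "\<lambda>p. \<bar>log 2 (prob (cyl A p))\<bar>"])
    (auto intro: finite_PiE assms)

lemma integral_info:
  assumes "finite A"
  shows "(\<integral>w. info A w \<partial>M) = block_entropy M act X A"
proof -
  have int: "integrable M (indicator (cyl A p) :: 'w \<Rightarrow> real)" for p
    by (simp add: emeasure_eq_measure)
  have "(\<integral>w. info A w \<partial>M)
    = (\<integral>w. (\<Sum>p\<in>PiE A (\<lambda>_. UNIV). - log 2 (prob (cyl A p)) * indicator (cyl A p) w) \<partial>M)"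
    by (intro Bochner_Integration.integral_cong refl info_eq_sum[OF assms])
  also have "\<dots> = (\<Sum>p\<in>PiE A (\<lambda>_. UNIV). - log 2 (prob (cyl A p)) * prob (cyl A p))"
  proof -
    have "cyl A p \<inter> space M = cyl A p" for p by (auto simp: cyl_def)
    then show ?thesis using int by simp
  qed
  also have "\<dots> = block_entropy M act X A"
    unfolding block_entropy_def cyl_def Let_def by (simp add: sum_negf mult.commute)
  finally show ?thesis .
qed

text \<open>There are finitely many names, hence finitely many null cylinders to avoid. Positivity
  is what permits writing the probability of a name as \<open>2 powr\<close> of minus its
  information.\<close>

lemma AE_prob_name_pos:
  assumes "finite A"
  shows "AE w in M. prob (cyl A (name A w)) > 0"
proof -
  have "AE w in M. prob (cyl A p) = 0 \<longrightarrow> w \<notin> cyl A p" for p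
  proof (cases "prob (cyl A p) = 0")
    case True
    then have "AE w in M. w \<notin> cyl A p"
      by (intro AE_I[of _ _ "cyl A p"]) (auto simp: emeasure_eq_measure)
    then show ?thesis by eventually_elim simp
  qed simp
  then have "AE w in M. \<forall>p\<in>PiE A (\<lambda>_. UNIV). prob (cyl A p) = 0 \<longrightarrow> w \<notin> cyl A p"
    using assms by (intro AE_finite_allI finite_PiE) auto
  then show ?thesis
    using AE_space
  proof eventually_elim
    case (elim w)
    then have "w \<in> cyl A (name A w)" by (simp add: mem_cyl_iff)
    then have "prob (cyl A (name A w)) \<noteq> 0" using elim(1) name_PiE by blast
    then show ?case by (simp add: zero_less_measure_iff)
  qed
qed

text \<open>The upper half of the Shannon-McMillan-Breiman theorem in counting form. The threshold
  \<open>t k\<close> bounds the number of accepted configurations through the Kraft inequality,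
  while the ergodic theorem for \<open>info A\<close> shows that almost every point is eventually
  accepted.\<close>

lemma typical_names:
  fixes F :: "nat \<Rightarrow> 'g set" and h :: real
  assumes F: "tempered_folner_seq F"
    and h: "(\<lambda>k. block_entropy M act X (F k) / card (F k)) \<longlonglongrightarrow> h" and "\<epsilon> > 0"
  obtains Gd :: "nat \<Rightarrow> ('g \<Rightarrow> 's) set"
  where "\<And>k. finite (Gd k)"
    "\<forall>\<^sub>F k in sequentially. card (Gd k) \<le> 2 powr ((h + \<epsilon>) * card (F k))"
    "AE w in M. \<forall>\<^sub>F k in sequentially. name (F k) w \<in> Gd k"
proof -
  \<comment> \<open>One third is lost in choosing the window \<open>A\<close>, one in the
    convergence of the ergodic averages, and one in the boundary factor of the Kraft bound.\<close>
  define \<delta> where "\<delta> = \<epsilon> / 3"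
  have "\<delta> > 0" using \<open>\<epsilon> > 0\<close> by (simp add: \<delta>_def)
  have F': "folner_seq F" using F by (simp add: tempered_folner_seq_def)
  have "\<forall>\<^sub>F k in sequentially. block_entropy M act X (F k) / card (F k) < h + \<delta>"
    using h \<open>\<delta> > 0\<close> by (intro order_tendstoD) auto
  then obtain j where j: "block_entropy M act X (F j) / card (F j) < h + \<delta>"
    by (auto simp: eventually_sequentially)
  define A where "A = F j"
  let ?m = "real (card A)" and ?S = "real CARD('s)"
  have A: "finite A" "A \<noteq> {}" and m: "?m > 0"
    unfolding A_def using folner_seq_finite[OF F'] folner_seq_nonempty[OF F'] folner_seq_card_pos[OF F']
    by auto
  define q where "q p = prob (cyl A p)" for p
  \<comment> \<open>The windows \<open>A f\<close> may stick out of \<open>F k\<close>, so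
    configurations are counted on this larger set; restricting them to \<open>F k\<close> cannot
    increase their number.\<close>
  define V where "V k = F k \<union> set_prod A (F k)" for k
  define t where "t k = 2 powr (- ((h + 2 * \<delta>) * card (F k)))" for k
  define Y where "Y k = {y \<in> PiE (V k) (\<lambda>_. UNIV).
      t k \<le> (\<Prod>f\<in>F k. q (\<lambda>a\<in>A. y (a + f)) powr (1 / card A))}" for k
  define Gd where "Gd k = (\<lambda>y. restrict y (F k)) ` Y k" for k
  have finV: "finite (V k)" for k using A folner_seq_finite[OF F'] by (simp add: V_def)
  then have finY: "finite (Y k)" for k by (simp add: Y_def finite_PiE)
  show thesis
  proof
    show "finite (Gd k)" for k using finY by (simp add: Gd_def)
    show "\<forall>\<^sub>F k in sequentially. card (Gd k) \<le> 2 powr ((h + \<epsilon>) * card (F k))"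
    proof -
      have "(\<lambda>k. log 2 ?S * (card (set_prod A (F k) - F k) / card (F k))) \<longlonglongrightarrow> log 2 ?S * 0"
        by (intro tendsto_intros folner_seq_set_prod F' A)
      then have "\<forall>\<^sub>F k in sequentially. log 2 ?S * (card (set_prod A (F k) - F k) / card (F k)) < \<delta>"
        using \<open>\<delta> > 0\<close> by (intro order_tendstoD) auto
      then show ?thesis
      proof eventually_elim
        case (elim k)
        let ?r = "card (set_prod A (F k) - F k)"
        have Fk: "card (F k) > 0" by (rule folner_seq_card_pos[OF F'])
        have "card (Gd k) \<le> card (Y k)" unfolding Gd_def by (rule card_image_le[OF finY])
        also have "real (card (Y k)) \<le> ?S ^ ?r / t k"
          unfolding Y_def V_def
          by (rule card_likely_configurations_le)
            (auto simp: A folner_seq_finite[OF F'] q_def sum_prob_cyl t_def)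
        also have "?S ^ ?r = 2 powr (log 2 ?S * ?r)"
          by (simp add: powr_powr[symmetric] powr_realpow)
        also have "\<dots> / t k = 2 powr (log 2 ?S * ?r + (h + 2 * \<delta>) * card (F k))"
          by (simp add: t_def powr_diff[symmetric])
        also have "\<dots> \<le> 2 powr ((h + \<epsilon>) * card (F k))"
          using elim Fk by (intro powr_mono) (auto simp: \<delta>_def field_simps)
        finally show ?case by simp
      qed
    qed
    have "AE w in M. (\<lambda>k. ave (F k) (info A) w) \<longlonglongrightarrow> block_entropy M act X A"
      unfolding integral_info[OF A(1), symmetric]
      by (rule pointwise_ergodic[OF F info_measurable[OF A(1)] info_bounded[OF A(1)]])
    moreover have "AE w in M. \<forall>f. prob (cyl A (name A (act f w))) > 0"
      using AE_act[OF AE_prob_name_pos[OF A(1)]] by (simp add: AE_all_countable)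
    ultimately show "AE w in M. \<forall>\<^sub>F k in sequentially. name (F k) w \<in> Gd k"
      using AE_space
    proof eventually_elim
      case (elim w)
      have "block_entropy M act X A < (h + 2 * \<delta>) * ?m"
      proof -
        have "block_entropy M act X A < (h + \<delta>) * ?m"
          using j m by (simp add: A_def pos_divide_less_eq)
        also have "\<dots> \<le> (h + 2 * \<delta>) * ?m" using m \<open>\<delta> > 0\<close> by (intro mult_right_mono) auto
        finally show ?thesis .
      qed
      with elim(1) have "\<forall>\<^sub>F k in sequentially. ave (F k) (info A) w < (h + 2 * \<delta>) * ?m"
        by (rule order_tendstoD)
      then show ?case
      proof eventually_elim
        case (elim k)
        have Fk: "real (card (F k)) > 0" using folner_seq_card_pos[OF F'] by simp
        let ?y = "name (V k) w"
        have q_eq: "q (\<lambda>a\<in>A. ?y (a + f)) powr (1 / card A) = 2 powr (- info A (act f w) / ?m)"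
          if f: "f \<in> F k" for f
        proof -
          have "a + f \<in> V k" if "a \<in> A" for a using f that by (auto simp: V_def set_prod_def)
          then have "(\<lambda>a\<in>A. ?y (a + f)) = name A (act f w)"
            using \<open>w \<in> space M\<close> by (auto simp: name_def act_add restrict_def)
          then have "q (\<lambda>a\<in>A. ?y (a + f)) = 2 powr (- info A (act f w))"
            using \<open>\<forall>f. prob (cyl A (name A (act f w))) > 0\<close> by (simp add: q_def info_def)
          then show ?thesis by (simp add: powr_powr)
        qed
        have "(\<Prod>f\<in>F k. q (\<lambda>a\<in>A. ?y (a + f)) powr (1 / card A))
            = 2 powr (\<Sum>f\<in>F k. - info A (act f w) / ?m)"
          using folner_seq_finite[OF F'] by (simp add: q_eq powr_sum)
        also have "(\<Sum>f\<in>F k. - info A (act f w) / ?m) = - (ave (F k) (info A) w / ?m * card (F k))"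
          using Fk by (simp add: ave_def sum_negf sum_divide_distrib[symmetric])
        also have "2 powr \<dots> \<ge> t k"
          unfolding t_def
        proof (rule powr_mono)
          have "ave (F k) (info A) w / ?m \<le> h + 2 * \<delta>" using elim m by (simp add: field_simps)
          then show "- ((h + 2 * \<delta>) * card (F k)) \<le> - (ave (F k) (info A) w / ?m * card (F k))"
            using Fk by (intro le_imp_neg_le mult_right_mono) auto
        qed simp
        finally have "?y \<in> Y k" unfolding Y_def by (intro CollectI conjI name_PiE)
        moreover have "name (F k) w = restrict ?y (F k)"
          by (auto simp: name_def V_def restrict_def)
        ultimately show ?case unfolding Gd_def by blast
      qed
    qed
  qed
qed

end

end

section \<open>Packing and filling\<close>

text \<open>Any point \<open>f\<close> of \<open>S\<close> is put first and the rest is chosen from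
  \<open>S\<close> without \<open>W f\<close>, a smaller set since \<open>W\<close> contains the
  identity. The result meets the premise of the filling property.\<close>

lemma greedy_list:
  fixes W :: "'g::group_add set"
  assumes "0 \<in> W" "finite S"
  shows "\<exists>fs. set fs \<subseteq> S \<and> (\<forall>i<length fs. fs ! i \<notin> (\<Union>j<i. translate_right W (fs ! j)))
    \<and> S \<subseteq> (\<Union>i<length fs. translate_right W (fs ! i))"
  using \<open>finite S\<close>
proof (induction S rule: finite_psubset_induct)
  case (psubset S)
  show ?case
  proof (cases "S = {}")
    case True
    then show ?thesis by (intro exI[of _ "[]"]) simp
  next
    case False
    then obtain f where f: "f \<in> S" by blast
    have "f \<in> translate_right W f"
      using \<open>0 \<in> W\<close> by (force simp: translate_right_def)
    then have "S - translate_right W f \<subset> S" using f by blast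
    from psubset.IH[OF this] obtain fs where
      fs: "set fs \<subseteq> S - translate_right W f"
        "\<And>i. i < length fs \<Longrightarrow> fs ! i \<notin> (\<Union>j<i. translate_right W (fs ! j))"
        "S - translate_right W f \<subseteq> (\<Union>i<length fs. translate_right W (fs ! i))"
      by blast
    have split: "(\<Union>j<Suc i. translate_right W ((f # fs) ! j))
        = translate_right W f \<union> (\<Union>j<i. translate_right W (fs ! j))" for i
      by (simp add: lessThan_Suc_eq_insert_0 image_image)
    have "(f # fs) ! i \<notin> (\<Union>j<i. translate_right W ((f # fs) ! j))" if i: "i < length (f # fs)" for i
    proof (cases i)
      case (Suc i')
      then have "i' < length fs" using i by simp
      then have "fs ! i' \<in> S - translate_right W f" using fs(1) nth_mem by blast
      with fs(2)[OF \<open>i' < length fs\<close>] show ?thesis unfolding Suc split by simp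
    qed simp
    moreover have "S \<subseteq> (\<Union>i<length (f # fs). translate_right W ((f # fs) ! i))"
      using fs(3) by (simp only: length_Cons split) blast
    moreover have "set (f # fs) \<subseteq> S" using f fs(1) by auto
    ultimately show ?thesis by blast
  qed
qed

text \<open>The greedy translates cover \<open>S\<close> and hold at most \<open>N\<close> points of
  it each, so their number is at least \<open>card S / N\<close> when \<open>N > 0\<close>; filling
  bounds that number from above by the size of \<open>W S\<close>.\<close>

lemma filling_card_bound:
  fixes W :: "'g::group_add set" and C N :: real
  assumes W: "individually_filling W C" and "finite S" "C \<ge> 0" "N \<ge> 0"
    and sparse: "\<And>g. g \<in> S \<Longrightarrow> card (S \<inter> translate_right W g) \<le> N"
  shows "C * card W * card S \<le> N * card (set_prod W S)"
proof -
  have fin: "finite W" and "0 \<in> W" using W by (auto simp: individually_filling_def)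
  obtain fs where fs: "set fs \<subseteq> S"
    "\<forall>i<length fs. fs ! i \<notin> (\<Union>j<i. translate_right W (fs ! j))"
    "S \<subseteq> (\<Union>i<length fs. translate_right W (fs ! i))"
    using greedy_list[OF \<open>0 \<in> W\<close> \<open>finite S\<close>] by blast
  let ?U = "\<Union>i<length fs. translate_right W (fs ! i)"
  have "C * (\<Sum>i<length fs. real (card (translate_right W (fs ! i)))) \<le> card ?U"
    using W fs(2) by (simp add: individually_filling_def)
  then have filling: "C * (length fs * card W) \<le> card ?U" by simp
  have nth: "fs ! i \<in> S" if "i < length fs" for i using fs(1) nth_mem[OF that] by blast
  then have "?U \<subseteq> set_prod W S" unfolding set_prod_translate_right by blast
  then have "card ?U \<le> card (set_prod W S)"
    using fin \<open>finite S\<close> by (intro card_mono) auto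
  with filling have len: "C * (length fs * card W) \<le> card (set_prod W S)" by linarith
  have "S = (\<Union>i<length fs. S \<inter> translate_right W (fs ! i))" using fs(3) by blast
  then have "card S \<le> (\<Sum>i<length fs. card (S \<inter> translate_right W (fs ! i)))"
    by (metis card_UN_le finite_lessThan)
  then have "real (card S) \<le> (\<Sum>i<length fs. real (card (S \<inter> translate_right W (fs ! i))))"
    by (simp only: of_nat_le_iff flip: of_nat_sum)
  also have "\<dots> \<le> (\<Sum>i<length fs. N)"
    by (intro sum_mono sparse nth) simp
  finally have "C * card W * card S \<le> C * card W * (length fs * N)"
    using \<open>C \<ge> 0\<close> by (intro mult_left_mono) auto
  also have "\<dots> = N * (C * (length fs * card W))" by simp
  also have "\<dots> \<le> N * card (set_prod W S)" using len \<open>N \<ge> 0\<close> by (rule mult_left_mono)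
  finally show ?thesis .
qed

text \<open>Squaring \<open>y \<le> exp y\<close> at \<open>y = \<epsilon> * ln 2 / 2 * x\<close>.
  It absorbs the polynomial factor from \<open>card_repeats_le\<close> into an exponential.\<close>

lemma square_le_powr:
  fixes x \<epsilon> :: real
  assumes "\<epsilon> > 0" "x \<ge> 0"
  shows "x\<^sup>2 \<le> (2 / (\<epsilon> * ln 2))\<^sup>2 * 2 powr (\<epsilon> * x)"
proof -
  let ?a = "\<epsilon> * ln 2 / 2"
  have a: "?a > 0" using assms by simp
  have "?a * x \<le> exp (?a * x)" using exp_ge_add_one_self[of "?a * x"] by linarith
  then have "(?a * x)\<^sup>2 \<le> (exp (?a * x))\<^sup>2" using assms by (intro power_mono) auto
  also have "(exp (?a * x))\<^sup>2 = 2 powr (\<epsilon> * x)"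
    by (simp add: powr_def exp_double[symmetric] mult_ac)
  finally have "x\<^sup>2 * ?a\<^sup>2 \<le> 2 powr (\<epsilon> * x)"
    unfolding power_mult_distrib[of ?a x] by (simp only: mult.commute)
  then have "x\<^sup>2 \<le> 2 powr (\<epsilon> * x) / ?a\<^sup>2"
    using pos_le_divide_eq[OF zero_less_power[OF a]] by blast
  also have "\<dots> = (2 / (\<epsilon> * ln 2))\<^sup>2 * 2 powr (\<epsilon> * x)" by (simp add: power_divide)
  finally show ?thesis .
qed

section \<open>Recurrence of names and the almost sure rate\<close>

context ergodic_action
begin

text \<open>Let \<open>E\<close> be an optimal packing. A return \<open>f\<close> whose translate
  met no translate centred in \<open>E\<close> could be added to it, so all returns lie in the
  product of the inverse of \<open>A\<close>, \<open>A\<close> and \<open>E\<close>.\<close>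

lemma card_repeats_le:
  fixes X :: "'w \<Rightarrow> 's::finite"
  assumes A: "finite A" "A \<noteq> {}" and W: "finite W" "0 \<in> W" and w: "w \<in> space M"
  shows "card {f \<in> W. repeats_at act X A w f} \<le> (card A)\<^sup>2 * (U_stat act X A W w * card W)"
proof -
  define valid where "valid E \<longleftrightarrow> 0 \<in> E \<and> E \<subseteq> W \<and>
    (\<forall>f\<in>E. \<forall>f'\<in>E. f \<noteq> f' \<longrightarrow> translate_right A f \<inter> translate_right A f' = {}) \<and>
    (\<forall>f\<in>E. repeats_at act X A w f)" for E
  let ?R = "{f \<in> W. repeats_at act X A w f}" and ?S = "{card E |E. valid E}"
  have "?S \<subseteq> card ` Pow W" by (auto simp: valid_def)
  then have fin: "finite ?S" using W(1) finite_subset by blast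
  \<comment> \<open>Every point repeats at the identity, so the maximum is taken over a nonempty
    set.\<close>
  have "valid {0}" using W(2) w by (auto simp: valid_def repeats_at_def)
  then have "?S \<noteq> {}" by blast
  then have "Max ?S \<in> ?S" by (rule Max_in[OF fin])
  then obtain E where E: "valid E" "card E = Max ?S" by force
  have finE: "finite E" using E(1) W(1) finite_subset by (auto simp: valid_def)
  have "?R \<subseteq> set_prod (set_prod (set_inv A) A) E"
  proof (rule subsetI, rule ccontr)
    fix f assume f: "f \<in> ?R" "f \<notin> set_prod (set_prod (set_inv A) A) E"
    have disj: "translate_right A f \<inter> translate_right A e = {}" if "e \<in> E" for e
      unfolding translates_disjoint_iff using f(2) that by (auto simp: set_prod_def)
    have fE: "f \<notin> E"
    proof
      assume "f \<in> E"
      from disj[OF this] A(2) show False by (simp add: translate_right_def)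
    qed
    moreover have "translate_right A e \<inter> translate_right A f = {}" if "e \<in> E" for e
      using disj[OF that] by (simp only: Int_commute)
    ultimately have "valid (insert f E)" using E(1) f(1) disj unfolding valid_def by simp
    then have "card (insert f E) \<le> Max ?S" using fin by (intro Max_ge) auto
    then show False using fE finE E(2) by simp
  qed
  then have "card ?R \<le> card (set_prod (set_prod (set_inv A) A) E)"
    using A(1) finE by (intro card_mono) (auto simp: set_inv_def)
  also have "\<dots> \<le> card (set_prod (set_inv A) A) * card E" by (rule card_set_prod_le[OF finE])
  also have "\<dots> \<le> (card A * card A) * card E"
  proof (rule mult_right_mono)
    have "card (set_inv A) \<le> card A" unfolding set_inv_def by (rule card_image_le[OF A(1)])
    then show "card (set_prod (set_inv A) A) \<le> card A * card A"
      using card_set_prod_le[OF A(1), of "set_inv A"] mult_right_mono order_trans by blast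
  qed simp
  finally have "real (card ?R) \<le> real ((card A * card A) * card E)" by (simp only: of_nat_le_iff)
  moreover have "U_stat act X A W w = Max ?S / card W" by (simp only: U_stat_def valid_def)
  then have "U_stat act X A W w * card W = card E" using W by (auto simp: E(2))
  ultimately show ?thesis by (simp only: of_nat_mult of_nat_power power2_eq_square)
qed

text \<open>The maximum is below a threshold iff every admissible subset of the finite window is,
  which leaves finitely many conditions.\<close>

lemma U_stat_less_sets:
  fixes X :: "'w \<Rightarrow> 's::finite"
  assumes [measurable]: "X \<in> measurable M (count_space UNIV)" and W: "finite W" "0 \<in> W"
  shows "{w \<in> space M. U_stat act X A W w < \<delta>} \<in> sets M"
proof -
  define dis where "dis E \<longleftrightarrow>
    (\<forall>f\<in>E. \<forall>f'\<in>E. f \<noteq> f' \<longrightarrow> translate_right A f \<inter> translate_right A f' = {})" for E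
  define rep where "rep w E \<longleftrightarrow> (\<forall>f\<in>E. repeats_at act X A w f)" for w E
  have cW: "real (card W) > 0" using W by (auto simp: card_gt_0_iff)
  have eq: "U_stat act X A W w < \<delta> \<longleftrightarrow>
    (\<forall>E\<in>Pow W. 0 \<in> E \<and> dis E \<and> rep w E \<longrightarrow> card E < \<delta> * card W)"
    if w: "w \<in> space M" for w
  proof -
    let ?S = "{card E |E. 0 \<in> E \<and> E \<subseteq> W \<and> dis E \<and> rep w E}"
    have "?S \<subseteq> card ` Pow W" by auto
    then have fin: "finite ?S" using W(1) finite_subset by blast
    have "dis {0}" "rep w {0}" using w by (auto simp: dis_def rep_def repeats_at_def)
    then have ne: "?S \<noteq> {}" using W(2) by blast
    have "U_stat act X A W w < \<delta> \<longleftrightarrow> real (Max ?S) < \<delta> * card W"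
      using cW by (simp add: U_stat_def pos_divide_less_eq dis_def rep_def)
    also have "\<dots> \<longleftrightarrow> (\<forall>s\<in>?S. real s < \<delta> * card W)"
    proof
      assume "real (Max ?S) < \<delta> * card W"
      then show "\<forall>s\<in>?S. real s < \<delta> * card W"
        using Max_ge[OF fin] by (meson le_less_trans of_nat_le_iff)
    next
      assume "\<forall>s\<in>?S. real s < \<delta> * card W"
      then show "real (Max ?S) < \<delta> * card W" using Max_in[OF fin ne] by (rule bspec)
    qed
    also have "\<dots> \<longleftrightarrow> (\<forall>E\<in>Pow W. 0 \<in> E \<and> dis E \<and> rep w E \<longrightarrow> card E < \<delta> * card W)"
      by blast
    finally show ?thesis .
  qed
  have [measurable]: "Measurable.pred M (\<lambda>w. rep w E)" for E
  proof -
    \<comment> \<open>Agreement of two letters is spelled out over the finite alphabet, reducing it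
      to level sets of \<open>X\<close>.\<close>
    have "rep w E \<longleftrightarrow>
      (\<forall>f\<in>E. \<forall>g\<in>A. \<forall>s. X (act g (act f w)) = s \<longleftrightarrow> X (act g w) = s)" for w
      by (auto simp: rep_def repeats_at_def)
    then show ?thesis by simp
  qed
  have "{w \<in> space M. \<forall>E\<in>Pow W. 0 \<in> E \<and> dis E \<and> rep w E \<longrightarrow> card E < \<delta> * card W} \<in> sets M"
    using W(1) by (intro sets.sets_Collect_finite_All) auto
  moreover have "{w \<in> space M. U_stat act X A W w < \<delta>}
    = {w \<in> space M. \<forall>E\<in>Pow W. 0 \<in> E \<and> dis E \<and> rep w E \<longrightarrow> card E < \<delta> * card W}"
    by (intro Collect_cong conj_cong refl eq)
  ultimately show ?thesis by simp
qed

text \<open>Let \<open>S\<close> be the times in \<open>T\<close> at which the orbit visits the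
  event. Two visits carry the same name \<open>p\<close>, so the visits inside \<open>W g\<close>,
  for \<open>g\<close> in \<open>S\<close>, are returns of the point at \<open>g\<close>, and
  \<open>card_repeats_le\<close> makes them sparse. The filling property turns this into a density
  bound, which is transferred with the constant function 1.\<close>

lemma prob_rare_recurrence_le:
  fixes X :: "'w \<Rightarrow> 's::finite" and F :: "nat \<Rightarrow> 'g set" and C \<delta> :: real
  assumes X: "X \<in> measurable M (count_space UNIV)" and F: "folner_seq F"
    and A: "finite A" "A \<noteq> {}" and W: "individually_filling W C" and "C > 0" "\<delta> \<ge> 0"
  shows "prob (cyl X A p \<inter> {w \<in> space M. U_stat act X A W w < \<delta>}) \<le> (card A)\<^sup>2 * \<delta> / C"
proof -
  have finW: "finite W" "0 \<in> W" using W by (auto simp: individually_filling_def)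
  have cW: "real (card W) > 0" using finW by (auto simp: card_gt_0_iff)
  let ?D = "cyl X A p \<inter> {w \<in> space M. U_stat act X A W w < \<delta>}"
  have "prob ?D \<le> (card A)\<^sup>2 * \<delta> / C * (\<integral>w. 1 \<partial>M)"
  proof (rule transference[OF F finW(1)])
    fix w and T :: "'g set" assume w: "w \<in> space M" and T: "finite T"
    let ?S = "{g \<in> T. act g w \<in> ?D}" and ?N = "(card A)\<^sup>2 * \<delta> * card W"
    have "C * card W * card ?S \<le> ?N * card (set_prod W ?S)"
    proof (rule filling_card_bound[OF W])
      fix g assume g: "g \<in> ?S"
      let ?R = "{f \<in> W. repeats_at act X A (act g w) f}"
      have gw: "act g w \<in> space M" using w by simp
      have "?S \<inter> translate_right W g \<subseteq> translate_right ?R g"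
      proof
        fix v assume v: "v \<in> ?S \<inter> translate_right W g"
        then obtain f where f: "f \<in> W" "v = f + g" by (auto simp: translate_right_def)
        have "act f (act g w) \<in> cyl X A p" using v f(2) w by (simp add: act_add)
        then have "repeats_at act X A (act g w) f"
          using g by (simp add: repeats_at_def cyl_def[OF X])
        then show "v \<in> translate_right ?R g" using f by (auto simp: translate_right_def)
      qed
      then have "card (?S \<inter> translate_right W g) \<le> card ?R"
        using card_mono[of "translate_right ?R g"] finW(1) by simp
      then have "real (card (?S \<inter> translate_right W g)) \<le> card ?R" by simp
      also have "\<dots> \<le> (card A)\<^sup>2 * (U_stat act X A W (act g w) * card W)"
        by (rule card_repeats_le[OF A finW gw])
      also have "\<dots> \<le> (card A)\<^sup>2 * (\<delta> * card W)"
        using g by (intro mult_left_mono mult_right_mono) auto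
      finally show "card (?S \<inter> translate_right W g) \<le> ?N" by (simp add: mult.assoc)
    qed (use T \<open>C > 0\<close> \<open>\<delta> \<ge> 0\<close> in auto)
    also have "\<dots> \<le> ?N * card (set_prod W T)"
    proof -
      have "set_prod W ?S \<subseteq> set_prod W T" by (auto simp: set_prod_def)
      then have "card (set_prod W ?S) \<le> card (set_prod W T)"
        using finW T by (intro card_mono) auto
      then show ?thesis using \<open>\<delta> \<ge> 0\<close> by (intro mult_left_mono) auto
    qed
    finally have "card W * (C * card ?S) \<le> card W * ((card A)\<^sup>2 * \<delta> * card (set_prod W T))"
      by (simp add: mult_ac)
    then have "C * card ?S \<le> (card A)\<^sup>2 * \<delta> * card (set_prod W T)"
      using cW by (simp only: mult_le_cancel_left_pos)
    then show "card ?S \<le> (card A)\<^sup>2 * \<delta> / C * (\<Sum>v\<in>set_prod W T. 1)"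
      using \<open>C > 0\<close> by (simp add: field_simps)
  qed (use \<open>C > 0\<close> \<open>\<delta> \<ge> 0\<close> cyl_sets[OF X] U_stat_less_sets[OF X finW] in auto)
  then show ?thesis by (simp add: prob_space)
qed

text \<open>A union bound over the typical names feeds Borel-Cantelli. A point with typical name
  outside the bad set \<open>B k\<close> lies in the cylinder of its own name, hence its packing
  density is at least \<open>\<delta> k\<close>.\<close>

lemma AE_eventually_recurrence_rate:
  fixes X :: "'w \<Rightarrow> 's::finite" and h :: real and F W :: "nat \<Rightarrow> 'g set"
  assumes X: "X \<in> measurable M (count_space UNIV)" and F: "tempered_folner_seq F"
    and h: "(\<lambda>k. block_entropy M act X (F k) / card (F k)) \<longlonglongrightarrow> h"
    and W: "\<And>m. individually_filling (W m) (C m)" and C: "\<And>k. C (n k) > 0"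
    and sum: "\<And>\<alpha>. \<alpha> > 0 \<Longrightarrow> summable (\<lambda>k. 2 powr (- \<alpha> * real (card (F k))) / C (n k))"
    and "\<epsilon> > 0"
  shows "AE w in M. \<forall>\<^sub>F k in sequentially.
    - log 2 (U_stat act X (F k) (W (n k)) w) / card (F k) \<le> h + 3 * \<epsilon>"
proof -
  have F': "folner_seq F" using F by (simp add: tempered_folner_seq_def)
  note Fk = folner_seq_finite[OF F'] folner_seq_nonempty[OF F'] folner_seq_card_pos[OF F']
  have finW: "finite (W m)" "0 \<in> W m" for m using W[of m] by (auto simp: individually_filling_def)
  obtain Gd :: "nat \<Rightarrow> ('g \<Rightarrow> 's) set" where Gd: "\<And>k. finite (Gd k)"
    "\<forall>\<^sub>F k in sequentially. card (Gd k) \<le> 2 powr ((h + \<epsilon>) * card (F k))"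
    "AE w in M. \<forall>\<^sub>F k in sequentially. name X (F k) w \<in> Gd k"
    using typical_names[OF X F h \<open>\<epsilon> > 0\<close>] by blast
  define \<delta> where "\<delta> k = 2 powr (- ((h + 3 * \<epsilon>) * card (F k)))" for k
  define D where "D k p = cyl X (F k) p \<inter> {w \<in> space M. U_stat act X (F k) (W (n k)) w < \<delta> k}" for k p
  define B where "B k = (\<Union>p\<in>Gd k. D k p)" for k
  have D_sets: "D k p \<in> sets M" for k p
    unfolding D_def using cyl_sets[OF X] U_stat_less_sets[OF X finW] by blast
  then have B_sets: "B k \<in> sets M" for k
    unfolding B_def using Gd(1) by (intro sets.finite_UN) auto
  let ?c = "(2 / (\<epsilon> * ln 2))\<^sup>2"
  have "\<forall>\<^sub>F k in sequentially. norm (prob (B k)) \<le> ?c * (2 powr (- \<epsilon> * card (F k)) / C (n k))"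
    using Gd(2)
  proof eventually_elim
    case (elim k)
    let ?x = "real (card (F k))"
    have "prob (B k) \<le> (\<Sum>p\<in>Gd k. prob (D k p))"
      unfolding B_def using D_sets Gd(1) by (intro finite_measure_subadditive_finite) auto
    also have "\<dots> \<le> (\<Sum>p\<in>Gd k. (card (F k))\<^sup>2 * \<delta> k / C (n k))"
      unfolding D_def
      by (intro sum_mono prob_rare_recurrence_le[OF X F' Fk(1,2) W C]) (simp add: \<delta>_def)
    also have "\<dots> = card (Gd k) * (?x\<^sup>2 * \<delta> k / C (n k))" by simp
    also have "\<dots> \<le> 2 powr ((h + \<epsilon>) * ?x) * (?c * 2 powr (\<epsilon> * ?x) * \<delta> k / C (n k))"
      using elim square_le_powr[OF \<open>\<epsilon> > 0\<close>, of ?x] C[of k]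
      by (intro mult_mono divide_right_mono mult_right_mono) (auto simp: \<delta>_def)
    also have "\<dots> = ?c * (2 powr ((h + \<epsilon>) * ?x) * 2 powr (\<epsilon> * ?x) * \<delta> k / C (n k))" by simp
    also have "2 powr ((h + \<epsilon>) * ?x) * 2 powr (\<epsilon> * ?x) * \<delta> k = 2 powr (- \<epsilon> * ?x)"
      unfolding \<delta>_def powr_add[symmetric] by (simp add: algebra_simps)
    finally show ?case by simp
  qed
  then have "summable (\<lambda>k. prob (B k))"
    by (rule summable_comparison_test_ev) (intro summable_mult sum \<open>\<epsilon> > 0\<close>)
  then have "AE w in M. \<forall>\<^sub>F k in sequentially. w \<in> space M - B k"
    using B_sets by (intro borel_cantelli_AE1) (auto simp: emeasure_eq_measure)
  with Gd(3) show ?thesis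
    using AE_space
  proof eventually_elim
    case (elim w)
    from elim(1,2) show ?case
    proof eventually_elim
      case (elim k)
      have "w \<in> cyl X (F k) (name X (F k) w)"
        using \<open>w \<in> space M\<close> name_PiE[OF X] by (simp add: mem_cyl_iff[OF X])
      then have "\<delta> k \<le> U_stat act X (F k) (W (n k)) w"
        using elim \<open>w \<in> space M\<close> by (auto simp: B_def D_def not_less)
      moreover have "0 < \<delta> k" by (simp add: \<delta>_def)
      ultimately have "log 2 (\<delta> k) \<le> log 2 (U_stat act X (F k) (W (n k)) w)"
        by (intro log_mono) auto
      then have "- log 2 (U_stat act X (F k) (W (n k)) w) \<le> (h + 3 * \<epsilon>) * card (F k)"
        by (simp add: \<delta>_def)
      then show ?case using Fk(3)[of k] by (subst pos_divide_le_eq) auto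
    qed
  qed
qed

end

theorem theorem3p3:
  fixes M :: "'w::polish_space measure"
    and act :: "'g::{group_add, countable} \<Rightarrow> 'w \<Rightarrow> 'w"
    and X :: "'w \<Rightarrow> 's::finite"
    and h :: real
    and F W :: "nat \<Rightarrow> 'g set"
    and C :: "nat \<Rightarrow> real"
    and n :: "nat \<Rightarrow> nat"
  assumes "amenable TYPE('g)"
    and "prob_space M"
    and "sets M = sets borel"
    and "mp_free_ergodic_action M act"
    and "X \<in> measurable M (count_space UNIV)"
    and "tempered_folner_seq F"
    and "\<forall>k. card (F k) \<ge> k"
    and "(\<lambda>k. block_entropy M act X (F k) / real (card (F k))) \<longlonglongrightarrow> h"
    and "\<forall>m. individually_filling (W m) (C m)"
    and "\<forall>k. C (n k) > 0"
    and "\<forall>\<alpha>>0. summable (\<lambda>k. 2 powr (- \<alpha> * real (card (F k))) / C (n k))"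
  shows "AE w in M. limsup (\<lambda>k. ereal (- log 2 (U_stat act X (F k) (W (n k)) w) / real (card (F k))))
            \<le> ereal h"
proof -
  interpret prob_space M by fact
  interpret ergodic_action M act
  proof
    show "A \<in> sets M \<Longrightarrow> (\<And>g. act g -` A \<inter> space M = A) \<Longrightarrow> prob A = 0 \<or> prob A = 1" for A
      using assms(4) unfolding mp_free_ergodic_action_def by blast
  qed (use assms(4) in \<open>auto simp: mp_free_ergodic_action_def\<close>)
  let ?u = "\<lambda>w k. - log 2 (U_stat act X (F k) (W (n k)) w) / real (card (F k))"
  \<comment> \<open>Only countably many slacks are used, so the exceptional null sets can be united
    before \<open>m\<close> tends to infinity.\<close>
  have "AE w in M. \<forall>\<^sub>F k in sequentially. ?u w k \<le> h + 3 * inverse (real (Suc m))" for m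
    using assms by (intro AE_eventually_recurrence_rate) auto
  then have "AE w in M. \<forall>m. \<forall>\<^sub>F k in sequentially. ?u w k \<le> h + 3 * inverse (real (Suc m))"
    by (simp add: AE_all_countable)
  then show ?thesis
  proof eventually_elim
    case (elim w)
    have le: "limsup (\<lambda>k. ereal (?u w k)) \<le> ereal (h + 3 * inverse (real (Suc m)))" for m
      by (rule Limsup_bounded) (use elim[rule_format, of m] in \<open>auto elim: eventually_mono\<close>)
    have lim: "(\<lambda>m. ereal (h + 3 * inverse (real (Suc m)))) \<longlonglongrightarrow> ereal (h + 3 * 0)"
      by (intro tendsto_intros LIMSEQ_inverse_real_of_nat)
    have "limsup (\<lambda>k. ereal (?u w k)) \<le> ereal (h + 3 * 0)"
      by (rule LIMSEQ_le_const[OF lim]) (use le in blast)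
    then show ?case by simp
  qed
qed

end
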